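(* Let $\lambda\in\mathbb{D}\setminus\{0\}$ be fixed. There is a constant $c(\lambda)>0$ depending only on $\lambda$ such that for every $n\ge 1$ the following holds. Let $T_\lambda\in\mathcal{M}_n$ be the lower triangular Toeplitz matrix $$T_{\lambda}=\begin{pmatrix} \lambda & 0 & \cdots & \cdots & 0\\ 1-|\lambda|^{2} & \lambda & \ddots & & \vdots\\ -\bar{\lambda}(1-|\lambda|^{2}) & 1-|\lambda|^{2} & \lambda & \ddots & \vdots\\ \vdots & \ddots & \ddots & \ddots & 0\\ (-\bar{\lambda})^{n-2}(1-|\lambda|^{2}) & \cdots & -\bar{\lambda}(1-|\lambda|^{2}) & 1-|\lambda|^{2} & \lambda \end{pmatrix},$$ that is, $(T_\lambda)_{ii}=\lambda$, $(T_\lambda)_{ij}=(-\bar\lambda)^{\,i-j-1}(1-|\lambda|^2)$ for $i>j$, and $(T_\lambda)_{ij}=0$ for $i<j$. Then $T_\lambda$ is power-bounded, and there exists a norm on $\mathbb{C}^n$ whose induced operator norm $\|\cdot\|$ on $\mathcal{M}_n$ satisfies $\|T_\lambda\|\le 1$ and $$\mathcal{S}(n)\;\ge\;\|\det(T_\lambda)\,T_\lambda^{-1}\|\;\ge\; c(\lambda)\sqrt{n}.$$ In particular $T_\lambda$ is a counterexample to Schäffer's conjecture that $\mathcal{S}(n)$ is bounded in $n$.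
   Context: $\mathbb{D}$ is the open unit disk in $\mathbb{C}$; $\mathcal{M}_n$ is the set of complex $n\times n$ matrices. $\mathcal{S}(n)$ denotes the smallest constant $\mathcal{S}$ such that $|\det T|\,\|T^{-1}\|\le \mathcal{S}\,\|T\|^{n-1}$ holds for every invertible $T\in\mathcal{M}_n$ and every operator norm $\|\cdot\|$ on $\mathcal{M}_n$ induced by a norm on $\mathbb{C}^n$. A matrix $T$ is power-bounded if $\sup_{l\ge0}\|T^l\|<\infty$ (for one, equivalently any, norm). *)

theory Defs
  imports
    Complex_Main
    "Jordan_Normal_Form.Gauss_Jordan_Elimination"
    "Jordan_Normal_Form.Determinant"
begin

definition is_vec_norm :: "nat \<Rightarrow> (complex vec \<Rightarrow> real) \<Rightarrow> bool" where
  "is_vec_norm n N \<longleftrightarrow>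
     (\<forall>v \<in> carrier_vec n. 0 \<le> N v \<and> (N v = 0 \<longleftrightarrow> v = 0\<^sub>v n)) \<and>
     (\<forall>a. \<forall>v \<in> carrier_vec n. N (a \<cdot>\<^sub>v v) = cmod a * N v) \<and>
     (\<forall>v \<in> carrier_vec n. \<forall>w \<in> carrier_vec n. N (v + w) \<le> N v + N w)"

definition op_norm :: "nat \<Rightarrow> (complex vec \<Rightarrow> real) \<Rightarrow> complex mat \<Rightarrow> real" where
  "op_norm n N A = Sup {N (A *\<^sub>v v) | v. v \<in> carrier_vec n \<and> N v \<le> 1}"

text \<open>Meaningful for invertible matrices only: otherwise \<open>mat_inverse\<close> returns \<open>None\<close>.\<close>

abbreviation mat_inv :: "complex mat \<Rightarrow> complex mat" where
  "mat_inv A \<equiv> the (mat_inverse A)"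

text \<open>All norms on a finite-dimensional space are equivalent, so quantifying over all norms
  here is the same as fixing one of them.\<close>

definition power_bounded :: "nat \<Rightarrow> complex mat \<Rightarrow> bool" where
  "power_bounded n A \<longleftrightarrow>
     (\<forall>N. is_vec_norm n N \<longrightarrow> bdd_above (range (\<lambda>l. op_norm n N (A ^\<^sub>m l))))"

text \<open>Intended for \<open>n \<ge> 1\<close>, as the exponent \<open>n - 1\<close> is a truncated subtraction.\<close>

definition schaeffer_const :: "nat \<Rightarrow> real" where
  "schaeffer_const n =
     (LEAST S. \<forall>A N. A \<in> carrier_mat n n \<longrightarrow> invertible_mat A \<longrightarrow> is_vec_norm n N \<longrightarrow>
        cmod (det A) * op_norm n N (mat_inv A) \<le> S * op_norm n N A ^ (n - 1))"

definition toeplitz_mat :: "complex \<Rightarrow> nat \<Rightarrow> complex mat" where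
  "toeplitz_mat z n = mat n n (\<lambda>(i, j).
     if i = j then z
     else if j < i then (- cnj z) ^ (i - j - 1) * (1 - (complex_of_real (cmod z))\<^sup>2)
     else 0)"

end

theory Submission
  imports
    "HOL-Analysis.Topology_Euclidean_Space"
    Defs
    "HOL-Computational_Algebra.Formal_Power_Series"
    "Jordan_Normal_Form.Schur_Decomposition"
begin

text \<open>
  Identify \<open>\<complex>\<^sup>n\<close> with power series modulo \<open>X\<^sup>n\<close>. The Toeplitz matrix \<open>T\<close> is then multiplication by
  the Blaschke factor \<open>\<phi> = (z + X) / (1 + cnj z X)\<close>, and \<open>det T \<cdot> T\<^sup>-\<^sup>1\<close> is multiplication by
  \<open>z\<^sup>n / \<phi>\<close>. The norm is the supremum of the last coordinate along the orbit,
  \<open>N v = sup\<^sub>k \<bar>[X\<^sup>n\<^sup>-\<^sup>1] (\<phi>\<^sup>k v)\<bar>\<close>. It is finite because \<open>\<phi>\<^sup>k\<close> has coefficients of modulus at most 1,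
  it is definite because the last coordinate is cyclic for the transpose of \<open>T\<close>, and
  \<open>N (T v) \<le> N v\<close> holds because the supremum for \<open>T v\<close> runs over a tail of the orbit. Power
  boundedness follows by equivalence of norms.

  It remains to find a vector that \<open>det T \<cdot> T\<^sup>-\<^sup>1\<close> stretches by a multiple of \<open>\<surd>n\<close>. For a
  polynomial \<open>h\<close> of small degree, the last coordinate of \<open>(z\<^sup>n / \<phi>) h\<close> is
  \<open>\<plusminus>(1 - \<bar>z\<bar>\<^sup>2) h(-z)\<close>, which does not depend on \<open>n\<close> except for its sign. So \<open>N h = O(n\<^sup>-\<^sup>1\<^sup>/\<^sup>2)\<close>
  is what is needed. The coefficient of \<open>h \<phi>\<^sup>k\<close> is the oscillatory integral of
  \<open>h(w) \<phi>(w)\<^sup>k w\<^sup>-\<^sup>n\<close> over the unit circle. Its phase can have degenerate critical points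
  only at \<open>w = \<plusminus>u\<close> with \<open>u = z / \<bar>z\<bar>\<close>; these would produce coefficients of order \<open>n\<^sup>-\<^sup>1\<^sup>/\<^sup>3\<close>, and
  \<open>h = X\<^sup>2 - u\<^sup>2\<close> is chosen to vanish at both of them (\<open>test_vec_norm_small\<close>,
  \<open>adjugate_test_vec_large\<close>).

  After a rotation, \<open>N h\<close> is a supremum of differences \<open>\<bar>a\<^sub>n\<^sub>-\<^sub>1 - a\<^sub>n\<^sub>-\<^sub>3\<bar>\<close> of coefficients of
  \<open>((r + X) / (1 + r X))\<^sup>k\<close> with \<open>r = \<bar>z\<bar>\<close>. They are bounded without integrals. The differential
  equation of this power makes \<open>m a\<^sub>m\<close> a solution of a three-term recurrence, which has a
  quadratic energy that grows by a total of at most \<open>k (1 - r\<^sup>2) / r\<close>, since the squares of the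
  coefficients sum to at most 1. The energy controls the differences while the recurrence
  oscillates; on both sides of the oscillating range the solution is monotone up to sign, which
  reduces the differences there to those at the turning points (\<open>jump_square_le\<close>,
  \<open>blaschke_power_difference_bound\<close>).

  The constant \<open>\<S>(n)\<close> is a least element, so it bounds anything only if it exists. The set of
  admissible constants is closed and bounded below; it is nonempty because the Cayley-Hamilton
  theorem writes \<open>det A \<cdot> A\<^sup>-\<^sup>1\<close> as a polynomial in \<open>A\<close> whose coefficients are controlled by the
  spectral radius (\<open>det_mult_inverse_bound\<close>, \<open>schaeffer_const_bound\<close>).\<close>

section \<open>Norms on complex n-space and their operator norms\<close>

lemma mult_mat_vec_index_sum:
  assumes "A \<in> carrier_mat m n" "v \<in> carrier_vec n" "i < m"
  shows "vec_index (A *\<^sub>v v) i = (\<Sum>j<n. A $$ (i, j) * vec_index v j)"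
  using assms by (auto simp: scalar_prod_def atLeast0LessThan intro!: sum.cong)

lemma is_vec_normD:
  assumes "is_vec_norm n N" "v \<in> carrier_vec n"
  shows "0 \<le> N v" "N v = 0 \<longleftrightarrow> v = 0\<^sub>v n" "N (a \<cdot>\<^sub>v v) = cmod a * N v"
    "w \<in> carrier_vec n \<Longrightarrow> N (v + w) \<le> N v + N w"
  using assms unfolding is_vec_norm_def by auto

lemma vec_norm_zero: "is_vec_norm n N \<Longrightarrow> N (0\<^sub>v n) = 0"
  by (simp add: is_vec_normD(2))

lemma vec_norm_minus_le:
  assumes N: "is_vec_norm n N" and v: "v \<in> carrier_vec n" and w: "w \<in> carrier_vec n"
  shows "N (v - w) \<le> N v + N w"
proof -
  have "v - w = v + (- 1) \<cdot>\<^sub>v w"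
    using v w by (intro eq_vecI) auto
  then show ?thesis
    using is_vec_normD(4)[OF N v, of "(- 1) \<cdot>\<^sub>v w"] is_vec_normD(3)[OF N w, of "- 1"] w by simp
qed

lemma vec_norm_le_coordinate_sum:
  assumes N: "is_vec_norm n N" and v: "v \<in> carrier_vec n"
  shows "N v \<le> (\<Sum>i<n. cmod (vec_index v i) * N (unit_vec n i))"
proof -
  define p where "p k = vec n (\<lambda>i. if i < k then vec_index v i else 0)" for k
  have "N (p k) \<le> (\<Sum>i<k. cmod (vec_index v i) * N (unit_vec n i))" if "k \<le> n" for k
    using that
  proof (induction k)
    case 0
    have "p 0 = 0\<^sub>v n"
      by (auto simp: p_def)
    then show ?case
      using vec_norm_zero[OF N] by simp
  next
    case (Suc k)
    have "p (Suc k) = p k + vec_index v k \<cdot>\<^sub>v unit_vec n k"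
      using Suc.prems by (intro eq_vecI) (auto simp: p_def less_Suc_eq)
    then have "N (p (Suc k)) \<le> N (p k) + cmod (vec_index v k) * N (unit_vec n k)"
      using is_vec_normD(4)[OF N, of "p k" "vec_index v k \<cdot>\<^sub>v unit_vec n k"]
      by (simp add: is_vec_normD(3)[OF N] p_def)
    then show ?case
      using Suc by simp
  qed
  moreover have "p n = v"
    using v by (intro eq_vecI) (auto simp: p_def)
  ultimately show ?thesis
    by (metis order_refl)
qed

text \<open>Compactness of the unit sphere, in sequential form: vectors of coordinate sum 1 whose norms tend
  to 0 have a coordinatewise convergent subsequence, and its limit is a nonzero vector of norm 0.\<close>

lemma vec_norm_controls_coordinates:
  assumes N: "is_vec_norm n N"
  obtains M where "0 \<le> M"
    "\<And>v i. v \<in> carrier_vec n \<Longrightarrow> i < n \<Longrightarrow> cmod (vec_index v i) \<le> M * N v"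
proof -
  define s where "s v = (\<Sum>i<n. cmod (vec_index v i))" for v
  have "\<exists>M. \<forall>v\<in>carrier_vec n. s v \<le> M * N v"
  proof (rule ccontr)
    assume "\<not> ?thesis"
    then have "\<forall>j. \<exists>v\<in>carrier_vec n. real (Suc j) * N v < s v"
      by (auto simp: not_le)
    then obtain w where w: "\<And>j. w j \<in> carrier_vec n" and Nw: "\<And>j. real (Suc j) * N (w j) < s (w j)"
      by metis
    have sw: "0 < s (w j)" for j
      using Nw[of j] is_vec_normD(1)[OF N w, of j]
      by (meson mult_nonneg_nonneg of_nat_0_le_iff le_less_trans)
    define f where "f j = complex_of_real (1 / s (w j)) \<cdot>\<^sub>v w j" for j
    have f: "f j \<in> carrier_vec n" for j
      using w by (simp add: f_def)
    have "s (f j) = (\<Sum>i<n. 1 / s (w j) * cmod (vec_index (w j) i))" for j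
      unfolding s_def[of "f j"] using w[of j] sw[of j]
      by (intro sum.cong) (auto simp: f_def norm_mult norm_divide)
    then have sf: "s (f j) = 1" for j
      using sw[of j] by (simp add: sum_divide_distrib[symmetric] s_def[of "w j", symmetric])
    have Nf: "N (f j) < 1 / real (Suc j)" for j
    proof -
      have "N (f j) = N (w j) / s (w j)"
        unfolding f_def using is_vec_normD(3)[OF N w] sw[of j] by (simp add: norm_divide)
      then have "real (Suc j) * N (f j) < 1"
        using Nw[of j] sw[of j] by (simp add: pos_divide_less_eq del: of_nat_Suc)
      then show ?thesis
        by (simp add: pos_less_divide_eq mult.commute del: of_nat_Suc)
    qed
    have bdd: "cmod (vec_index (f j) i) \<le> 1" if "i < n" for i j
      using member_le_sum[of i "{..<n}" "\<lambda>i. cmod (vec_index (f j) i)"] that sf[of j]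
      by (simp add: s_def)
    define g where "g j = (\<lambda>i. vec_index (f j) i)" for j
    have g_bdd: "bounded ((\<lambda>x. x k) ` range g)" if "k \<in> {..<n}" for k
      using bdd that by (auto simp: bounded_iff g_def intro!: exI[of _ 1])
    obtain l and r :: "nat \<Rightarrow> nat" where r: "strict_mono r"
      and l: "\<And>e. 0 < e \<Longrightarrow> eventually (\<lambda>j. \<forall>i\<in>{..<n}. dist (g (r j) i) (l i) < e) sequentially"
      using compact_lemma_general[of "{..<n}" "\<lambda>x k. x k" g "\<lambda>x. x", OF _ g_bdd]
      by (simp only: finite_lessThan refl simp_thms) (meson order_refl)
    have lim: "(\<lambda>j. vec_index (f (r j)) i) \<longlonglongrightarrow> l i" if "i < n" for i
      unfolding tendsto_iff
    proof (intro allI impI)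
      fix e :: real assume "0 < e"
      from l[OF this] show "\<forall>\<^sub>F j in sequentially. dist (vec_index (f (r j)) i) (l i) < e"
        by eventually_elim (use that in \<open>auto simp: g_def\<close>)
    qed
    define v where "v = vec n l"
    have v: "v \<in> carrier_vec n"
      by (simp add: v_def)
    have "(\<lambda>j. s (f (r j))) \<longlonglongrightarrow> (\<Sum>i<n. cmod (l i))"
      unfolding s_def by (intro tendsto_sum tendsto_norm lim) auto
    then have "(\<Sum>i<n. cmod (l i)) = 1"
      using sf by (simp add: LIMSEQ_const_iff)
    then have sv: "s v = 1"
      by (simp add: s_def v_def)
    have "N v \<le> (\<Sum>i<n. cmod (l i - vec_index (f (r j)) i) * N (unit_vec n i)) + 1 / real (Suc j)" for j
    proof -
      have "v = (v - f (r j)) + f (r j)"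
        using v f[of "r j"] by (intro eq_vecI) auto
      then have "N v \<le> N (v - f (r j)) + N (f (r j))"
        using is_vec_normD(4)[OF N, of "v - f (r j)" "f (r j)"] v f by (metis minus_carrier_vec)
      also have "N (v - f (r j)) \<le> (\<Sum>i<n. cmod (vec_index (v - f (r j)) i) * N (unit_vec n i))"
        using v f by (intro vec_norm_le_coordinate_sum N) auto
      also have "\<dots> = (\<Sum>i<n. cmod (l i - vec_index (f (r j)) i) * N (unit_vec n i))"
        using f[of "r j"] by (intro sum.cong) (auto simp: v_def)
      also have "N (f (r j)) \<le> 1 / real (Suc (r j))"
        using Nf less_imp_le by blast
      also have "\<dots> \<le> 1 / real (Suc j)"
        using seq_suble[OF r, of j] by (intro divide_left_mono) auto
      finally show ?thesis by simp
    qed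
    moreover have "(\<lambda>j. (\<Sum>i<n. cmod (l i - vec_index (f (r j)) i) * N (unit_vec n i)) + 1 / real (Suc j))
        \<longlonglongrightarrow> (\<Sum>i<n. cmod (l i - l i) * N (unit_vec n i)) + 0"
      by (intro tendsto_add tendsto_sum tendsto_mult tendsto_norm tendsto_diff tendsto_const lim
          LIMSEQ_inverse_real_of_nat[unfolded inverse_eq_divide]) auto
    ultimately have "N v \<le> (\<Sum>i<n. cmod (l i - l i) * N (unit_vec n i)) + 0"
      by (intro LIMSEQ_le_const) auto
    then have "N v = 0"
      using is_vec_normD(1)[OF N v] by simp
    then have "v = 0\<^sub>v n"
      using is_vec_normD(2)[OF N v] by simp
    then have "s v = 0"
      by (simp add: s_def)
    with sv show False by simp
  qed
  then obtain M where M: "\<And>v. v \<in> carrier_vec n \<Longrightarrow> s v \<le> M * N v"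
    by blast
  show thesis
  proof (rule that[of "max 0 M"])
    fix v :: "complex vec" and i assume v: "v \<in> carrier_vec n" and i: "i < n"
    have "cmod (vec_index v i) \<le> s v"
      unfolding s_def using member_le_sum[of i "{..<n}" "\<lambda>i. cmod (vec_index v i)"] i by simp
    also have "\<dots> \<le> max 0 M * N v"
      using M[OF v] mult_right_mono[of M "max 0 M" "N v"] is_vec_normD(1)[OF N v] by linarith
    finally show "cmod (vec_index v i) \<le> max 0 M * N v" .
  qed simp
qed

lemma vec_norms_equivalent:
  assumes N: "is_vec_norm n N" and N': "is_vec_norm n N'"
  obtains c where "0 \<le> c" "\<And>v. v \<in> carrier_vec n \<Longrightarrow> N v \<le> c * N' v"
proof -
  obtain M where M: "0 \<le> M"
    "\<And>v i. v \<in> carrier_vec n \<Longrightarrow> i < n \<Longrightarrow> cmod (vec_index v i) \<le> M * N' v"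
    using vec_norm_controls_coordinates[OF N'] by blast
  define c where "c = (\<Sum>i<n. M * N (unit_vec n i))"
  have pos: "0 \<le> N (unit_vec n i)" for i
    by (rule is_vec_normD(1)[OF N]) simp
  have "0 \<le> c"
    unfolding c_def using M(1) pos by (intro sum_nonneg mult_nonneg_nonneg) auto
  moreover have "N v \<le> c * N' v" if v: "v \<in> carrier_vec n" for v
  proof -
    have "N v \<le> (\<Sum>i<n. cmod (vec_index v i) * N (unit_vec n i))"
      by (rule vec_norm_le_coordinate_sum[OF N v])
    also have "\<dots> \<le> (\<Sum>i<n. M * N' v * N (unit_vec n i))"
      using M(2)[OF v] pos by (intro sum_mono mult_right_mono) auto
    also have "\<dots> = c * N' v"
      unfolding c_def sum_distrib_right by (intro sum.cong refl) (simp only: mult_ac)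
    finally show ?thesis .
  qed
  ultimately show thesis
    by (rule that)
qed

lemma mat_bounded_in_vec_norm:
  assumes N: "is_vec_norm n N" and A: "A \<in> carrier_mat n n"
  obtains C where "0 \<le> C" "\<And>v. v \<in> carrier_vec n \<Longrightarrow> N (A *\<^sub>v v) \<le> C * N v"
proof -
  obtain M where M: "0 \<le> M"
    "\<And>v i. v \<in> carrier_vec n \<Longrightarrow> i < n \<Longrightarrow> cmod (vec_index v i) \<le> M * N v"
    using vec_norm_controls_coordinates[OF N] by blast
  define C where "C = (\<Sum>i<n. (\<Sum>j<n. cmod (A $$ (i, j)) * M) * N (unit_vec n i))"
  have "0 \<le> C"
    unfolding C_def using M is_vec_normD(1)[OF N]
    by (intro sum_nonneg mult_nonneg_nonneg) auto
  moreover have "N (A *\<^sub>v v) \<le> C * N v" if v: "v \<in> carrier_vec n" for v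
  proof -
    have "cmod (vec_index (A *\<^sub>v v) i) \<le> (\<Sum>j<n. cmod (A $$ (i, j)) * M) * N v" if i: "i < n" for i
    proof -
      have "vec_index (A *\<^sub>v v) i = (\<Sum>j<n. A $$ (i, j) * vec_index v j)"
        by (rule mult_mat_vec_index_sum[OF A v i])
      then have "cmod (vec_index (A *\<^sub>v v) i) \<le> (\<Sum>j<n. cmod (A $$ (i, j)) * cmod (vec_index v j))"
        by (simp add: sum_norm_le norm_mult)
      also have "\<dots> \<le> (\<Sum>j<n. cmod (A $$ (i, j)) * (M * N v))"
        using M(2)[OF v] by (intro sum_mono mult_left_mono) auto
      finally show ?thesis
        by (simp add: sum_distrib_right mult.assoc)
    qed
    then have "(\<Sum>i<n. cmod (vec_index (A *\<^sub>v v) i) * N (unit_vec n i))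
        \<le> (\<Sum>i<n. (\<Sum>j<n. cmod (A $$ (i, j)) * M) * N v * N (unit_vec n i))"
      using is_vec_normD(1)[OF N] by (intro sum_mono mult_right_mono) auto
    also have "\<dots> = C * N v"
      unfolding C_def sum_distrib_right[of "\<lambda>i. _ i * N (unit_vec n i)"]
      by (intro sum.cong refl) (simp only: mult_ac)
    finally show ?thesis
      using vec_norm_le_coordinate_sum[OF N, of "A *\<^sub>v v"] A v by auto
  qed
  ultimately show thesis
    using that by blast
qed

lemma op_norm_le:
  assumes N: "is_vec_norm n N" and A: "A \<in> carrier_mat n n"
    and le: "\<And>v. v \<in> carrier_vec n \<Longrightarrow> N (A *\<^sub>v v) \<le> c * N v" and c: "0 \<le> c"
  shows "op_norm n N A \<le> c"
  unfolding op_norm_def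
proof (rule cSup_least)
  show "{N (A *\<^sub>v v) |v. v \<in> carrier_vec n \<and> N v \<le> 1} \<noteq> {}"
    using vec_norm_zero[OF N] by (auto intro!: exI[of _ "0\<^sub>v n"])
next
  fix y assume "y \<in> {N (A *\<^sub>v v) |v. v \<in> carrier_vec n \<and> N v \<le> 1}"
  then obtain v where "y = N (A *\<^sub>v v)" "v \<in> carrier_vec n" "N v \<le> 1"
    by auto
  then show "y \<le> c"
    using le[of v] mult_left_le[OF _ c, of "N v"] by simp
qed

text \<open>The supremum of an unbounded set of reals is an arbitrary value, so this inequality rests on
  \<open>mat_bounded_in_vec_norm\<close>, that is, on the equivalence of norms.\<close>

lemma vec_norm_mult_le_op_norm:
  assumes N: "is_vec_norm n N" and A: "A \<in> carrier_mat n n" and v: "v \<in> carrier_vec n"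
  shows "N (A *\<^sub>v v) \<le> op_norm n N A * N v"
proof (cases "N v = 0")
  case True
  then have "v = 0\<^sub>v n"
    using is_vec_normD(2)[OF N v] by simp
  then have "A *\<^sub>v v = 0\<^sub>v n"
    using A by (intro eq_vecI) auto
  then show ?thesis
    using True vec_norm_zero[OF N] by simp
next
  case False
  then have pos: "0 < N v"
    using is_vec_normD(1)[OF N v] by simp
  obtain C where C: "0 \<le> C" "\<And>v. v \<in> carrier_vec n \<Longrightarrow> N (A *\<^sub>v v) \<le> C * N v"
    using mat_bounded_in_vec_norm[OF N A] by blast
  define w where "w = complex_of_real (1 / N v) \<cdot>\<^sub>v v"
  have w: "w \<in> carrier_vec n" "N w = 1"
    using v pos is_vec_normD(3)[OF N v] by (auto simp: w_def norm_divide)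
  have "N (A *\<^sub>v w) \<le> op_norm n N A"
    unfolding op_norm_def
  proof (rule cSup_upper)
    show "N (A *\<^sub>v w) \<in> {N (A *\<^sub>v v) |v. v \<in> carrier_vec n \<and> N v \<le> 1}"
      using w by auto
    show "bdd_above {N (A *\<^sub>v v) |v. v \<in> carrier_vec n \<and> N v \<le> 1}"
    proof (rule bdd_aboveI)
      fix y assume "y \<in> {N (A *\<^sub>v v) |v. v \<in> carrier_vec n \<and> N v \<le> 1}"
      then show "y \<le> C"
        using C(2) mult_left_le[OF _ C(1)] by (auto intro: order_trans)
    qed
  qed
  moreover have "N (A *\<^sub>v w) = N (A *\<^sub>v v) / N v"
    unfolding w_def mult_mat_vec[OF A v] using A v pos
    by (simp add: is_vec_normD(3)[OF N] norm_divide)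
  ultimately show ?thesis
    using pos by (simp add: pos_divide_le_eq)
qed

lemma op_norm_nonneg:
  assumes N: "is_vec_norm n N" and A: "A \<in> carrier_mat n n" and n: "0 < n"
  shows "0 \<le> op_norm n N A"
proof -
  have u: "unit_vec n 0 \<in> carrier_vec n" "unit_vec n 0 \<noteq> (0\<^sub>v n :: complex vec)"
    using n by auto
  then have "0 < N (unit_vec n 0)"
    using is_vec_normD(1,2)[OF N u(1)] by linarith
  moreover have "0 \<le> op_norm n N A * N (unit_vec n 0)"
    using vec_norm_mult_le_op_norm[OF N A u(1)] is_vec_normD(1)[OF N, of "A *\<^sub>v unit_vec n 0"] A
    by (metis mult_mat_vec_carrier order_trans u(1))
  ultimately show ?thesis
    by (simp add: zero_le_mult_iff)
qed

lemma power_bounded_if_contraction: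
  assumes N: "is_vec_norm n N" and A: "A \<in> carrier_mat n n"
    and contr: "\<And>v. v \<in> carrier_vec n \<Longrightarrow> N (A *\<^sub>v v) \<le> N v"
  shows "power_bounded n A"
  unfolding power_bounded_def
proof (intro allI impI)
  fix N' assume N': "is_vec_norm n N'"
  obtain c where c: "0 \<le> c" "\<And>v. v \<in> carrier_vec n \<Longrightarrow> N' v \<le> c * N v"
    using vec_norms_equivalent[OF N' N] by blast
  obtain d where d: "0 \<le> d" "\<And>v. v \<in> carrier_vec n \<Longrightarrow> N v \<le> d * N' v"
    using vec_norms_equivalent[OF N N'] by blast
  have pow: "N (A ^\<^sub>m l *\<^sub>v v) \<le> N v" if "v \<in> carrier_vec n" for l v
    using that
  proof (induction l arbitrary: v)
    case 0
    then show ?case using A by simp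
  next
    case (Suc l)
    have Av: "A *\<^sub>v v \<in> carrier_vec n"
      using A Suc.prems by simp
    have "A ^\<^sub>m Suc l *\<^sub>v v = A ^\<^sub>m l *\<^sub>v (A *\<^sub>v v)"
      using assoc_mult_mat_vec[OF pow_carrier_mat[OF A] A Suc.prems] by simp
    then show ?case
      using Suc.IH[OF Av] contr[OF Suc.prems] by simp
  qed
  show "bdd_above (range (\<lambda>l. op_norm n N' (A ^\<^sub>m l)))"
  proof (intro bdd_aboveI2 op_norm_le[OF N'] pow_carrier_mat[OF A])
    fix l and v :: "complex vec" assume v: "v \<in> carrier_vec n"
    have "N' (A ^\<^sub>m l *\<^sub>v v) \<le> c * N (A ^\<^sub>m l *\<^sub>v v)"
      using c(2) mult_mat_vec_carrier[OF pow_carrier_mat[OF A] v] by blast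
    also have "\<dots> \<le> c * (d * N' v)"
      using order_trans[OF pow[OF v] d(2)[OF v]] c(1) by (rule mult_left_mono)
    finally show "N' (A ^\<^sub>m l *\<^sub>v v) \<le> (c * d) * N' v"
      by (simp add: mult.assoc)
  qed (use c d in simp)
qed

section \<open>Finiteness of the constant\<close>

lemma smult_mat_mult_vec:
  fixes A :: "'a::comm_semiring_0 mat"
  assumes "A \<in> carrier_mat m n" "v \<in> carrier_vec n"
  shows "(c \<cdot>\<^sub>m A) *\<^sub>v v = c \<cdot>\<^sub>v (A *\<^sub>v v)"
  using assms by (intro eq_vecI) auto

lemma mult_mat_index_sum:
  assumes "X \<in> carrier_mat m n" "Y \<in> carrier_mat n l" "i < m" "j < l"
  shows "(X * Y) $$ (i, j) = (\<Sum>k<n. X $$ (i, k) * Y $$ (k, j))"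
  using assms by (auto simp: scalar_prod_def atLeast0LessThan intro!: sum.cong)

primrec shifted_prod :: "nat \<Rightarrow> complex mat \<Rightarrow> (nat \<Rightarrow> complex) \<Rightarrow> nat \<Rightarrow> complex mat" where
  "shifted_prod n A a 0 = 1\<^sub>m n"
| "shifted_prod n A a (Suc k) = shifted_prod n A a k * (A - a k \<cdot>\<^sub>m 1\<^sub>m n)"

text \<open>The quotient in the division of \<open>(X - a\<^sub>0) \<cdots> (X - a\<^sub>k\<^sub>-\<^sub>1)\<close> by \<open>X\<close>, evaluated at the matrix
  recursively in \<open>k\<close>. Multiplication by one more shifted factor is easy to estimate in any norm,
  whereas the expanded coefficients are elementary symmetric functions.\<close>

primrec shifted_quot :: "nat \<Rightarrow> complex mat \<Rightarrow> (nat \<Rightarrow> complex) \<Rightarrow> nat \<Rightarrow> complex mat" where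
  "shifted_quot n A a 0 = 0\<^sub>m n n"
| "shifted_quot n A a (Suc k) =
     shifted_quot n A a k * (A - a k \<cdot>\<^sub>m 1\<^sub>m n) + (\<Prod>i<k. - a i) \<cdot>\<^sub>m 1\<^sub>m n"

lemma shift_carrier [simp]:
  "A \<in> carrier_mat n n \<Longrightarrow> A - c \<cdot>\<^sub>m 1\<^sub>m n \<in> carrier_mat n n"
  by auto

lemma shifted_prod_carrier [simp]:
  "A \<in> carrier_mat n n \<Longrightarrow> shifted_prod n A a k \<in> carrier_mat n n"
  by (induction k) (auto intro!: mult_carrier_mat)

lemma shifted_quot_carrier [simp]:
  "A \<in> carrier_mat n n \<Longrightarrow> shifted_quot n A a k \<in> carrier_mat n n"
  by (induction k) (auto intro!: mult_carrier_mat add_carrier_mat)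

lemma shifted_prod_eq_quot:
  assumes A: "A \<in> carrier_mat n n"
  shows "shifted_prod n A a k = A * shifted_quot n A a k + (\<Prod>i<k. - a i) \<cdot>\<^sub>m 1\<^sub>m n"
proof (induction k)
  case 0
  then show ?case using A by auto
next
  case (Suc k)
  define Q where "Q = shifted_quot n A a k"
  define S where "S = A - a k \<cdot>\<^sub>m 1\<^sub>m n"
  define c where "c = (\<Prod>i<k. - a i)"
  have carr: "Q \<in> carrier_mat n n" "S \<in> carrier_mat n n" "A * Q \<in> carrier_mat n n"
    using A by (auto simp: Q_def S_def)
  have "shifted_prod n A a (Suc k) = (A * Q + c \<cdot>\<^sub>m 1\<^sub>m n) * S"
    using Suc by (simp add: Q_def S_def c_def)
  also have "\<dots> = A * (Q * S) + c \<cdot>\<^sub>m S"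
    using A carr by (simp add: add_mult_distrib_mat[of _ n n] mult_smult_assoc_mat[of _ n n])
  also have "c \<cdot>\<^sub>m S = c \<cdot>\<^sub>m A + (- a k * c) \<cdot>\<^sub>m 1\<^sub>m n"
    using A unfolding S_def by (intro eq_matI) (auto simp: algebra_simps)
  also have "A * (Q * S) + (c \<cdot>\<^sub>m A + (- a k * c) \<cdot>\<^sub>m 1\<^sub>m n)
      = (A * (Q * S) + c \<cdot>\<^sub>m A) + (- a k * c) \<cdot>\<^sub>m 1\<^sub>m n"
    using A carr by (intro assoc_add_mat[symmetric, of _ n n]) auto
  also have "A * (Q * S) + c \<cdot>\<^sub>m A = A * (Q * S + c \<cdot>\<^sub>m 1\<^sub>m n)"
    using A carr mult_carrier_mat[OF carr(1,2)]
    by (simp add: mult_add_distrib_mat[of _ n n _ n] mult_smult_distrib[of _ n n _ n])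
  finally show ?case
    by (simp add: Q_def S_def c_def mult.commute)
qed

text \<open>The flag argument for Cayley-Hamilton: each factor \<open>B - a\<^sub>k\<close> maps the span of the first \<open>k + 1\<close>
  unit vectors into the span of the first \<open>k\<close>.\<close>

lemma upper_triangular_shifted_prod:
  assumes B: "B \<in> carrier_mat n n" and ut: "upper_triangular B"
    and diag: "\<And>i. i < n \<Longrightarrow> B $$ (i, i) = a i"
  shows "k \<le> n \<Longrightarrow> i < n \<Longrightarrow> j < k \<Longrightarrow> shifted_prod n B a k $$ (i, j) = 0"
proof (induction k arbitrary: i j)
  case (Suc k)
  have "shifted_prod n B a (Suc k) $$ (i, j)
      = (\<Sum>l<n. shifted_prod n B a k $$ (i, l) * (B - a k \<cdot>\<^sub>m 1\<^sub>m n) $$ (l, j))"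
    using Suc.prems mult_mat_index_sum[OF shifted_prod_carrier[OF B] shift_carrier[OF B]] by simp
  also have "\<dots> = 0"
  proof (intro sum.neutral ballI)
    fix l assume l: "l \<in> {..<n}"
    show "shifted_prod n B a k $$ (i, l) * (B - a k \<cdot>\<^sub>m 1\<^sub>m n) $$ (l, j) = 0"
    proof (cases "l < k")
      case True
      then show ?thesis
        using Suc by simp
    next
      case False
      then have "(B - a k \<cdot>\<^sub>m 1\<^sub>m n) $$ (l, j) = 0"
        using upper_triangularD[OF ut, of j l] Suc.prems l B diag[of j]
        by (cases "l = j") (auto simp: less_Suc_eq)
      then show ?thesis by simp
    qed
  qed
  finally show ?case .
qed simp

lemma cayley_hamilton_product:
  assumes A: "A \<in> carrier_mat n n"
  obtains a where "\<And>i. i < n \<Longrightarrow> eigenvalue A (a i)" "det A = (\<Prod>i<n. a i)"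
    "shifted_prod n A a n = 0\<^sub>m n n"
proof -
  obtain as where cp: "char_poly A = (\<Prod>a\<leftarrow>as. [:- a, 1:])" and len: "length as = n"
    using char_poly_factorized[OF A] by blast
  obtain B P Q where schur: "schur_decomposition A as = (B, P, Q)"
    by (cases "schur_decomposition A as") auto
  have sim: "similar_mat_wit A B P Q" and ut: "upper_triangular B" and diag: "diag_mat B = as"
    using schur_decomposition[OF A cp schur] by auto
  note w = similar_mat_witD2[OF A sim]
  define a where "a i = as ! i" for i
  have Ba: "B $$ (i, i) = a i" if "i < n" for i
    using that w(5) unfolding a_def diag[symmetric] diag_mat_def by simp
  have "eigenvalue A (a i)" if "i < n" for i
  proof -
    have "poly (char_poly A) (a i) = (\<Prod>x\<leftarrow>as. a i - x)"
      unfolding cp by (simp add: poly_prod_list o_def)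
    also have "\<dots> = 0"
      using that len by (auto simp: prod_list_zero_iff a_def)
    finally show ?thesis
      using eigenvalue_root_char_poly[OF A] by simp
  qed
  moreover have "det A = (\<Prod>i<n. a i)"
  proof -
    have "det A = prod_list as"
      using det_similar[of A B] sim det_upper_triangular[OF ut w(5)] diag
      by (auto simp: similar_mat_def)
    also have "\<dots> = (\<Prod>i<n. a i)"
      by (simp add: prod.list_conv_set_nth len a_def atLeast0LessThan)
    finally show ?thesis .
  qed
  moreover have "shifted_prod n A a n = 0\<^sub>m n n"
  proof -
    have AP: "A * P = P * B"
      using w by (simp add: assoc_mult_mat[of _ n n _ n _ n])
    have shift: "(A - c \<cdot>\<^sub>m 1\<^sub>m n) * P = P * (B - c \<cdot>\<^sub>m 1\<^sub>m n)" for c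
    proof -
      have "(A - c \<cdot>\<^sub>m 1\<^sub>m n) * P = A * P - c \<cdot>\<^sub>m P"
        using w(4,6) by (simp add: minus_mult_distrib_mat[of _ n n] mult_smult_assoc_mat[of _ n n])
      moreover have "P * (B - c \<cdot>\<^sub>m 1\<^sub>m n) = P * B - c \<cdot>\<^sub>m P"
        using w(5,6) by (simp add: mult_minus_distrib_mat[of _ n n _ n] mult_smult_distrib[of _ n n _ n])
      ultimately show ?thesis
        using AP by simp
    qed
    have "shifted_prod n A a k * P = P * shifted_prod n B a k" for k
    proof (induction k)
      case 0
      then show ?case using w by simp
    next
      case (Suc k)
      have "shifted_prod n A a (Suc k) * P = shifted_prod n A a k * ((A - a k \<cdot>\<^sub>m 1\<^sub>m n) * P)"
        using w by (simp add: assoc_mult_mat[of _ n n _ n _ n])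
      also have "\<dots> = (shifted_prod n A a k * P) * (B - a k \<cdot>\<^sub>m 1\<^sub>m n)"
        unfolding shift using w by (simp add: assoc_mult_mat[of _ n n _ n _ n])
      also have "\<dots> = P * shifted_prod n B a (Suc k)"
        unfolding Suc using w by (simp add: assoc_mult_mat[of _ n n _ n _ n])
      finally show ?case .
    qed
    moreover have "shifted_prod n B a n = 0\<^sub>m n n"
      using upper_triangular_shifted_prod[OF w(5) ut Ba, of n] shifted_prod_carrier[OF w(5), of a n]
      by (intro eq_matI) auto
    ultimately have "shifted_prod n A a n * P = 0\<^sub>m n n"
      using w by simp
    then have "shifted_prod n A a n * P * Q = 0\<^sub>m n n"
      using w by simp
    moreover have "shifted_prod n A a n * P * Q = shifted_prod n A a n"
      using assoc_mult_mat[OF shifted_prod_carrier[OF A] w(6,7)] w(1) right_mult_one_mat[OF shifted_prod_carrier[OF A]]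
      by metis
    ultimately show ?thesis
      by simp
  qed
  ultimately show thesis
    by (rule that)
qed

lemma eigenvalue_le_op_norm:
  assumes N: "is_vec_norm n N" and A: "A \<in> carrier_mat n n" and e: "eigenvalue A c"
  shows "cmod c \<le> op_norm n N A"
proof -
  obtain v where v: "v \<in> carrier_vec n" "v \<noteq> 0\<^sub>v n" "A *\<^sub>v v = c \<cdot>\<^sub>v v"
    using e A unfolding eigenvalue_def eigenvector_def by auto
  have "0 < N v"
    using is_vec_normD(1,2)[OF N v(1)] v(2) by linarith
  moreover have "cmod c * N v \<le> op_norm n N A * N v"
    using vec_norm_mult_le_op_norm[OF N A v(1)] v is_vec_normD(3)[OF N v(1)] by simp
  ultimately show ?thesis
    by simp
qed

lemma mat_inv_eq:
  assumes A: "A \<in> carrier_mat n n" and det: "det A \<noteq> 0"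
  shows "A * mat_inv A = 1\<^sub>m n" "mat_inv A * A = 1\<^sub>m n" "mat_inv A \<in> carrier_mat n n"
proof -
  have "A \<in> Units (ring_mat TYPE(complex) n ())"
    by (rule det_non_zero_imp_unit[OF A det])
  then have "mat_inverse A \<noteq> None"
    using mat_inverse(1)[OF A, where b = "()"] by auto
  then show "A * mat_inv A = 1\<^sub>m n" "mat_inv A * A = 1\<^sub>m n" "mat_inv A \<in> carrier_mat n n"
    using mat_inverse(2)[OF A] by auto
qed

lemma invertible_mat_iff_det:
  assumes A: "A \<in> carrier_mat n n"
  shows "invertible_mat A \<longleftrightarrow> det (A :: complex mat) \<noteq> 0"
proof
  assume "invertible_mat A"
  then obtain B where AB: "A * B = 1\<^sub>m n" and BA: "B * A = 1\<^sub>m (dim_row B)"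
    using A unfolding invertible_mat_def inverts_mat_def by auto
  have "B \<in> carrier_mat n n"
    using arg_cong[OF AB, of dim_col] arg_cong[OF BA, of dim_col] A by auto
  then have "det A * det B = 1"
    using det_mult[OF A, of B] AB by simp
  then show "det A \<noteq> 0"
    by auto
next
  assume "det A \<noteq> 0"
  from mat_inv_eq[OF A this] show "invertible_mat A"
    using A unfolding invertible_mat_def inverts_mat_def by auto
qed

text \<open>If \<open>a\<^sub>i\<close> are the eigenvalues and \<open>Q\<close> is the quotient above for all \<open>n\<close> of them, Cayley-Hamilton reads
  \<open>A Q = \<plusminus>det A\<close>, so \<open>det A \<cdot> A\<^sup>-\<^sup>1 = \<plusminus>Q\<close>. With \<open>R = \<parallel>A\<parallel>\<close>, every shifted factor has norm at most
  \<open>2 R\<close>, which gives \<open>\<parallel>Q\<^sub>k\<^sub>+\<^sub>1\<parallel> \<le> 2 R \<parallel>Q\<^sub>k\<parallel> + R\<^sup>k\<close> and hence \<open>\<parallel>Q\<^sub>k\<parallel> \<le> (2\<^sup>k - 1) R\<^sup>k\<^sup>-\<^sup>1\<close>.\<close>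

lemma det_mult_inverse_bound:
  assumes N: "is_vec_norm n N" and A: "A \<in> carrier_mat n n" and det: "det A \<noteq> 0" and n: "0 < n"
  shows "cmod (det A) * op_norm n N (mat_inv A) \<le> 2 ^ n * op_norm n N A ^ (n - 1)"
proof -
  note inv = mat_inv_eq[OF A det]
  define R where "R = op_norm n N A"
  have R: "0 \<le> R"
    unfolding R_def by (rule op_norm_nonneg[OF N A n])
  obtain a where ev: "\<And>i. i < n \<Longrightarrow> eigenvalue A (a i)" and deta: "det A = (\<Prod>i<n. a i)"
    and CH: "shifted_prod n A a n = 0\<^sub>m n n"
    using cayley_hamilton_product[OF A] by blast
  have a: "cmod (a i) \<le> R" if "i < n" for i
    unfolding R_def by (rule eigenvalue_le_op_norm[OF N A ev[OF that]])
  have shift: "N ((A - a k \<cdot>\<^sub>m 1\<^sub>m n) *\<^sub>v v) \<le> 2 * R * N v"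
    if "k < n" and v: "v \<in> carrier_vec n" for k v
  proof -
    have "(A - a k \<cdot>\<^sub>m 1\<^sub>m n) *\<^sub>v v = A *\<^sub>v v - a k \<cdot>\<^sub>v v"
      using A v by (simp add: minus_mult_distrib_mat_vec[of _ n n] smult_mat_mult_vec[of _ n n])
    then have "N ((A - a k \<cdot>\<^sub>m 1\<^sub>m n) *\<^sub>v v) \<le> N (A *\<^sub>v v) + cmod (a k) * N v"
      using vec_norm_minus_le[OF N, of "A *\<^sub>v v" "a k \<cdot>\<^sub>v v"] A v is_vec_normD(3)[OF N v] by simp
    also have "\<dots> \<le> R * N v + R * N v"
      using a[OF that(1)] vec_norm_mult_le_op_norm[OF N A v] is_vec_normD(1)[OF N v]
      unfolding R_def by (intro add_mono mult_right_mono) auto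
    finally show ?thesis by simp
  qed
  have Q: "N (shifted_quot n A a k *\<^sub>v v) \<le> (2 ^ k - 1) * R ^ (k - 1) * N v"
    if "k \<le> n" and "v \<in> carrier_vec n" for k v
    using that
  proof (induction k arbitrary: v)
    case 0
    then have "shifted_quot n A a 0 *\<^sub>v v = 0\<^sub>v n"
      by (auto intro!: eq_vecI)
    then show ?case
      using vec_norm_zero[OF N] by simp
  next
    case (Suc k)
    define w where "w = (A - a k \<cdot>\<^sub>m 1\<^sub>m n) *\<^sub>v v"
    define c where "c = (\<Prod>i<k. - a i)"
    have w: "w \<in> carrier_vec n"
      unfolding w_def using Suc.prems by (intro mult_mat_vec_carrier[OF shift_carrier[OF A]])
    have Nv: "0 \<le> N v"
      using is_vec_normD(1)[OF N] Suc.prems by simp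
    have "cmod c = (\<Prod>i<k. cmod (a i))"
      unfolding c_def prod_norm[symmetric] norm_minus_cancel ..
    also have "\<dots> \<le> (\<Prod>i<k. R)"
      using a Suc.prems by (intro prod_mono) auto
    finally have c: "cmod c \<le> R ^ k"
      by simp
    have "shifted_quot n A a (Suc k) *\<^sub>v v = shifted_quot n A a k *\<^sub>v w + c \<cdot>\<^sub>v v"
      using A Suc.prems unfolding w_def c_def
      by (simp add: add_mult_distrib_mat_vec[of _ n n] smult_mat_mult_vec[of _ n n]
          assoc_mult_mat_vec[of _ n n _ n] mult_carrier_mat[of _ n n])
    then have "N (shifted_quot n A a (Suc k) *\<^sub>v v) \<le> N (shifted_quot n A a k *\<^sub>v w) + cmod c * N v"
      using is_vec_normD(4)[OF N, of "shifted_quot n A a k *\<^sub>v w" "c \<cdot>\<^sub>v v"]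
        is_vec_normD(3)[OF N, of v] mult_mat_vec_carrier[OF shifted_quot_carrier[OF A] w] Suc.prems by simp
    also have "\<dots> \<le> (2 ^ k - 1) * R ^ (k - 1) * (2 * R * N v) + R ^ k * N v"
    proof (intro add_mono mult_right_mono c Nv)
      have "N (shifted_quot n A a k *\<^sub>v w) \<le> (2 ^ k - 1) * R ^ (k - 1) * N w"
        using Suc.IH[OF _ w] Suc.prems by simp
      also have "\<dots> \<le> (2 ^ k - 1) * R ^ (k - 1) * (2 * R * N v)"
        using shift[of k v] Suc.prems R unfolding w_def
        by (intro mult_left_mono mult_nonneg_nonneg) auto
      finally show "N (shifted_quot n A a k *\<^sub>v w) \<le> (2 ^ k - 1) * R ^ (k - 1) * (2 * R * N v)" .
    qed
    also have "\<dots> = (2 ^ Suc k - 1) * R ^ k * N v"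
      by (cases k) (simp_all add: algebra_simps)
    finally show ?case
      by simp
  qed
  define c where "c = (\<Prod>i<n. - a i)"
  define Qn where "Qn = shifted_quot n A a n"
  have Qn: "Qn \<in> carrier_mat n n"
    using A by (simp add: Qn_def)
  have cdet: "cmod c = cmod (det A)"
    unfolding c_def deta prod_norm[symmetric] norm_minus_cancel ..
  have AQ: "A * Qn + c \<cdot>\<^sub>m 1\<^sub>m n = 0\<^sub>m n n"
    using shifted_prod_eq_quot[OF A, of a n] CH by (simp add: Qn_def c_def)
  have "mat_inv A * (A * Qn + c \<cdot>\<^sub>m 1\<^sub>m n) = (mat_inv A * A) * Qn + c \<cdot>\<^sub>m mat_inv A"
    using A Qn inv(3) by (simp add: mult_add_distrib_mat[of _ n n _ n] mult_smult_distrib[of _ n n _ n]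
        assoc_mult_mat[of _ n n _ n _ n])
  then have Qinv: "Qn + c \<cdot>\<^sub>m mat_inv A = 0\<^sub>m n n"
    unfolding AQ using inv Qn by simp
  have le: "cmod (det A) * N (mat_inv A *\<^sub>v v) \<le> 2 ^ n * R ^ (n - 1) * N v" if v: "v \<in> carrier_vec n" for v
  proof -
    have iv: "mat_inv A *\<^sub>v v \<in> carrier_vec n"
      using inv(3) v by auto
    have "(Qn + c \<cdot>\<^sub>m mat_inv A) *\<^sub>v v = Qn *\<^sub>v v + c \<cdot>\<^sub>v (mat_inv A *\<^sub>v v)"
      using Qn inv(3) v by (simp add: add_mult_distrib_mat_vec[of _ n n] smult_mat_mult_vec[of _ n n])
    moreover have "(Qn + c \<cdot>\<^sub>m mat_inv A) *\<^sub>v v = 0\<^sub>v n"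
      unfolding Qinv using v by (auto intro!: eq_vecI)
    ultimately have sum0: "Qn *\<^sub>v v + c \<cdot>\<^sub>v (mat_inv A *\<^sub>v v) = 0\<^sub>v n"
      by simp
    have "Qn *\<^sub>v v = (- c) \<cdot>\<^sub>v (mat_inv A *\<^sub>v v)"
    proof (rule eq_vecI)
      fix i assume "i < dim_vec ((- c) \<cdot>\<^sub>v (mat_inv A *\<^sub>v v))"
      then have i: "i < n" "i < dim_vec (mat_inv A *\<^sub>v v)"
        using inv(3) by auto
      have "vec_index (Qn *\<^sub>v v) i + c * vec_index (mat_inv A *\<^sub>v v) i = 0"
        using arg_cong[OF sum0, of "\<lambda>x. vec_index x i"] i by (simp del: index_mult_mat_vec dim_mult_mat_vec)
      then show "vec_index (Qn *\<^sub>v v) i = vec_index ((- c) \<cdot>\<^sub>v (mat_inv A *\<^sub>v v)) i"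
        using i by (simp add: add_eq_0_iff2 del: index_mult_mat_vec dim_mult_mat_vec)
    qed (use Qn inv(3) in auto)
    then have "cmod (det A) * N (mat_inv A *\<^sub>v v) = N (Qn *\<^sub>v v)"
      using is_vec_normD(3)[OF N iv, of "- c"] cdet by simp
    also have "\<dots> \<le> (2 ^ n - 1) * R ^ (n - 1) * N v"
      unfolding Qn_def using Q v by simp
    also have "\<dots> \<le> 2 ^ n * R ^ (n - 1) * N v"
      using R is_vec_normD(1)[OF N v] by (intro mult_right_mono) auto
    finally show ?thesis .
  qed
  have "op_norm n N (mat_inv A) \<le> 2 ^ n * R ^ (n - 1) / cmod (det A)"
  proof (rule op_norm_le[OF N inv(3)])
    show "N (mat_inv A *\<^sub>v v) \<le> 2 ^ n * R ^ (n - 1) / cmod (det A) * N v" if "v \<in> carrier_vec n" for v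
      using le[OF that] det by (simp add: field_simps)
    show "0 \<le> 2 ^ n * R ^ (n - 1) / cmod (det A)"
      using R by simp
  qed
  then show ?thesis
    using det unfolding R_def[symmetric] by (simp add: field_simps)
qed

lemma is_vec_norm_coordinate_sum: "is_vec_norm n (\<lambda>v. \<Sum>i<n. cmod (vec_index v i))"
  unfolding is_vec_norm_def
proof (intro conjI ballI allI)
  fix v :: "complex vec"
  assume v: "v \<in> carrier_vec n"
  show "0 \<le> (\<Sum>i<n. cmod (vec_index v i))"
    by (intro sum_nonneg norm_ge_zero)
  have "(\<Sum>i<n. cmod (vec_index v i)) = 0 \<longleftrightarrow> (\<forall>i<n. vec_index v i = 0)"
    by (subst sum_nonneg_eq_0_iff) auto
  also have "\<dots> \<longleftrightarrow> v = 0\<^sub>v n"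
    using v by (metis carrier_vecD eq_vecI index_zero_vec)
  finally show "(\<Sum>i<n. cmod (vec_index v i)) = 0 \<longleftrightarrow> v = 0\<^sub>v n" .
next
  fix a and v :: "complex vec"
  assume "v \<in> carrier_vec n"
  then show "(\<Sum>i<n. cmod (vec_index (a \<cdot>\<^sub>v v) i)) = cmod a * (\<Sum>i<n. cmod (vec_index v i))"
    unfolding sum_distrib_left by (intro sum.cong) (auto simp: norm_mult)
next
  fix v w :: "complex vec"
  assume "v \<in> carrier_vec n" "w \<in> carrier_vec n"
  then show "(\<Sum>i<n. cmod (vec_index (v + w) i)) \<le> (\<Sum>i<n. cmod (vec_index v i)) + (\<Sum>i<n. cmod (vec_index w i))"
    unfolding sum.distrib[symmetric] by (intro sum_mono) (auto simp: norm_triangle_ineq)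
qed

text \<open>A least element of a set of reals is defined by a description that is void if the minimum is not
  attained. Here it is: the admissible constants form a closed half-line, nonempty by
  \<open>det_mult_inverse_bound\<close> and bounded below because of the identity matrix.\<close>

lemma schaeffer_const_bound:
  assumes n: "1 \<le> n"
  shows "0 \<le> schaeffer_const n"
    and "is_vec_norm n N \<Longrightarrow> A \<in> carrier_mat n n \<Longrightarrow> invertible_mat A \<Longrightarrow>
      cmod (det A) * op_norm n N (mat_inv A) \<le> schaeffer_const n * op_norm n N A ^ (n - 1)"
proof -
  define P where "P S \<longleftrightarrow> (\<forall>A N. A \<in> carrier_mat n n \<longrightarrow> invertible_mat A \<longrightarrow> is_vec_norm n N \<longrightarrow>
        cmod (det A) * op_norm n N (mat_inv A) \<le> S * op_norm n N A ^ (n - 1))" for S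
  define Z where "Z = {S. P S}"
  have nonneg: "0 \<le> S" if "P S" for S
  proof (rule ccontr)
    assume neg: "\<not> 0 \<le> S"
    let ?I = "1\<^sub>m n :: complex mat"
    obtain N where N: "is_vec_norm n N"
      using is_vec_norm_coordinate_sum by blast
    have inv: "mat_inv ?I = ?I"
      using mat_inv_eq[of ?I n] by simp
    have u: "unit_vec n 0 \<in> carrier_vec n" "unit_vec n 0 \<noteq> (0\<^sub>v n :: complex vec)"
      using n by auto
    have Nu: "0 < N (unit_vec n 0)"
      using is_vec_normD(1,2)[OF N u(1)] u(2) by linarith
    have "N (unit_vec n 0) \<le> op_norm n N ?I * N (unit_vec n 0)"
      using vec_norm_mult_le_op_norm[OF N _ u(1), of ?I] by simp
    with Nu have pos: "0 < op_norm n N ?I"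
      by simp
    have "cmod (det ?I) * op_norm n N (mat_inv ?I) \<le> S * op_norm n N ?I ^ (n - 1)"
      using that[unfolded P_def, rule_format, OF one_carrier_mat _ N] invertible_mat_iff_det[of ?I n]
      by simp
    moreover have "S * op_norm n N ?I ^ (n - 1) \<le> 0"
      using neg pos by (intro mult_nonpos_nonneg) auto
    ultimately show False
      unfolding inv using pos by simp
  qed
  have "P (2 ^ n)"
    unfolding P_def
  proof (intro allI impI)
    fix A :: "complex mat" and N assume A: "A \<in> carrier_mat n n" and "invertible_mat A" and N: "is_vec_norm n N"
    then have "det A \<noteq> 0"
      using invertible_mat_iff_det[OF A] by simp
    then show "cmod (det A) * op_norm n N (mat_inv A) \<le> 2 ^ n * op_norm n N A ^ (n - 1)"
      using n by (intro det_mult_inverse_bound[OF N A]) auto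
  qed
  then have ne: "Z \<noteq> {}"
    by (auto simp: Z_def)
  have bdd: "bdd_below Z"
    using nonneg by (auto simp: Z_def intro!: bdd_belowI[of _ 0])
  have P_Inf: "P (Inf Z)"
    unfolding P_def
  proof (intro allI impI)
    fix A :: "complex mat" and N assume A: "A \<in> carrier_mat n n" and inv: "invertible_mat A" and N: "is_vec_norm n N"
    let ?L = "cmod (det A) * op_norm n N (mat_inv A)" and ?r = "op_norm n N A ^ (n - 1)"
    have all: "?L \<le> S * ?r" if "S \<in> Z" for S
      using that A inv N by (auto simp: Z_def P_def)
    show "?L \<le> Inf Z * ?r"
    proof (cases "?r = 0")
      case True
      obtain S where "S \<in> Z"
        using ne by blast
      from all[OF this] show ?thesis
        unfolding True by simp
    next
      case False
      then have r: "0 < ?r"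
        using op_norm_nonneg[OF N A] n by (simp add: order_less_le)
      have "?L / ?r \<le> Inf Z"
        using all r ne by (intro cInf_greatest) (auto simp: pos_divide_le_eq)
      then show ?thesis
        using r by (simp add: pos_divide_le_eq)
    qed
  qed
  have "schaeffer_const n = Inf Z"
    unfolding schaeffer_const_def P_def[symmetric]
    using P_Inf cInf_lower[OF _ bdd] by (intro Least_equality) (auto simp: Z_def)
  then have P: "P (schaeffer_const n)"
    using P_Inf by simp
  then show "0 \<le> schaeffer_const n"
    by (rule nonneg)
  show "is_vec_norm n N \<Longrightarrow> A \<in> carrier_mat n n \<Longrightarrow> invertible_mat A \<Longrightarrow>
      cmod (det A) * op_norm n N (mat_inv A) \<le> schaeffer_const n * op_norm n N A ^ (n - 1)"
    using P unfolding P_def by blast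
qed

lemma schaeffer_const_ge_contraction:
  assumes n: "1 \<le> n" and N: "is_vec_norm n N" and A: "A \<in> carrier_mat n n"
    and det: "det A \<noteq> 0" and contr: "op_norm n N A \<le> 1"
  shows "op_norm n N (det A \<cdot>\<^sub>m mat_inv A) \<le> schaeffer_const n"
proof -
  note inv = mat_inv_eq[OF A det]
  have pos: "0 \<le> op_norm n N A" "0 \<le> op_norm n N (mat_inv A)"
    using op_norm_nonneg[OF N] A inv n by auto
  have "op_norm n N (det A \<cdot>\<^sub>m mat_inv A) \<le> cmod (det A) * op_norm n N (mat_inv A)"
  proof (rule op_norm_le[OF N])
    fix v :: "complex vec" assume v: "v \<in> carrier_vec n"
    have "N ((det A \<cdot>\<^sub>m mat_inv A) *\<^sub>v v) = cmod (det A) * N (mat_inv A *\<^sub>v v)"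
      using inv v is_vec_normD(3)[OF N] by (simp add: smult_mat_mult_vec[of _ n n])
    then show "N ((det A \<cdot>\<^sub>m mat_inv A) *\<^sub>v v) \<le> cmod (det A) * op_norm n N (mat_inv A) * N v"
      using vec_norm_mult_le_op_norm[OF N inv(3) v] by (simp add: mult_left_mono mult.assoc)
  qed (use inv pos in auto)
  also have "\<dots> \<le> schaeffer_const n * op_norm n N A ^ (n - 1)"
    using schaeffer_const_bound(2)[OF n N A] invertible_mat_iff_det[OF A] det by simp
  also have "\<dots> \<le> schaeffer_const n"
    using schaeffer_const_bound(1)[OF n] contr pos by (intro mult_left_le power_le_one) auto
  finally show ?thesis .
qed

section \<open>A three-term recurrence with two turning points\<close>

text \<open>The numbers \<open>m A\<^sub>m\<close> satisfy \<open>B\<^sub>m\<^sub>+\<^sub>1 + B\<^sub>m\<^sub>-\<^sub>1 = (K / m - s) B\<^sub>m\<close>. The coefficient decreases with \<open>m\<close>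
  towards \<open>-s < -2\<close>: the solution grows while it exceeds 2, oscillates while it lies between \<open>-2\<close>
  and 2, and decays with alternating signs below \<open>-2\<close>. All estimates are uniform in \<open>K\<close>, which
  carries the exponent \<open>k\<close> of the application.\<close>

locale turning_point_recurrence =
  fixes A :: "nat \<Rightarrow> real" and K s :: real
  assumes s_gt_2: "2 < s"
    and K_nonneg: "0 \<le> K"
    and A1_nonneg: "0 \<le> A 1"
    and square_sum_le_1: "(\<Sum>j\<le>m. (A j)\<^sup>2) \<le> 1"
    and recurrence: "real (Suc (Suc m)) * A (Suc (Suc m)) + real m * A m
                       = (K - s * real (Suc m)) * A (Suc m)"
begin

definition B :: "nat \<Rightarrow> real" where "B m = real m * A m"

text \<open>The coefficient of the recurrence at the index \<open>m + 1\<close>; the same shift by one is used for the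
  energy and for the jump, so that index 0 needs no separate treatment.\<close>

definition x :: "nat \<Rightarrow> real" where "x m = K / real (Suc m) - s"

text \<open>If \<open>x\<close> were constant, this quadratic form would be conserved by the recurrence. It is positive
  definite exactly for \<open>\<bar>x\<bar> < 2\<close>.\<close>

definition energy :: "nat \<Rightarrow> real" where
  "energy m = (B (Suc m))\<^sup>2 + (B m)\<^sup>2 - x m * B (Suc m) * B m"

definition jump :: "nat \<Rightarrow> real" where "jump m = B (Suc (Suc m)) - B m"

text \<open>Collects the bounds for the two terms of \<open>jump_square\<close> near a turning point. What matters is that
  it depends neither on \<open>K\<close> nor on the index.\<close>

definition D :: real where "D = s\<^sup>2 + 16 * s + 32"

lemma B_0 [simp]: "B 0 = 0"
  by (simp add: B_def)

lemma B_rec: "B (Suc (Suc m)) = x m * B (Suc m) - B m"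
proof -
  have "x m * B (Suc m) = (K - s * real (Suc m)) * A (Suc m)"
    by (simp add: B_def x_def divide_simps)
  with recurrence[of m] show ?thesis
    unfolding B_def by linarith
qed

lemma x_antimono: "i \<le> j \<Longrightarrow> x j \<le> x i"
  unfolding x_def using K_nonneg by (simp add: frac_le)

lemma abs_A_le_1: "\<bar>A m\<bar> \<le> 1"
proof -
  have "(A m)\<^sup>2 \<le> (\<Sum>j\<le>m. (A j)\<^sup>2)"
    by (rule member_le_sum) auto
  with square_sum_le_1[of m] have "(A m)\<^sup>2 \<le> 1"
    by linarith
  then show ?thesis
    by (simp add: abs_square_le_1)
qed

lemma B_square_le: "(B m)\<^sup>2 \<le> (real m)\<^sup>2"
proof -
  have "(A m)\<^sup>2 \<le> 1"
    using abs_A_le_1[of m] by (simp add: abs_square_le_1)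
  then show ?thesis
    by (simp add: B_def power_mult_distrib mult_left_le)
qed

text \<open>The decrement of \<open>K / m\<close> from one index to the next is \<open>K / (m (m + 1))\<close>, and these
  denominators cancel the weights in \<open>B\<^sub>m B\<^sub>m\<^sub>+\<^sub>1\<close>.\<close>

lemma energy_Suc: "energy (Suc m) = energy m + K * A (Suc m) * A (Suc (Suc m))"
proof -
  have "energy (Suc m) - energy m = (x m - x (Suc m)) * (B (Suc m) * B (Suc (Suc m)))"
    unfolding energy_def B_rec[of m] by (simp add: power2_eq_square algebra_simps)
  also have "\<dots> = ((x m - x (Suc m)) * (real (Suc m) * real (Suc (Suc m)))) * (A (Suc m) * A (Suc (Suc m)))"
    by (simp only: B_def mult_ac)
  also have "(x m - x (Suc m)) * (real (Suc m) * real (Suc (Suc m))) = K"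
    by (simp add: x_def divide_simps) (simp add: algebra_simps)
  finally show ?thesis
    by simp
qed

text \<open>By the arithmetic-geometric mean inequality the increments of the energy sum to at most \<open>K\<close>
  times the sum of the squares of \<open>A\<close>.\<close>

lemma energy_le: "energy m \<le> 1 + K"
proof -
  have "energy m \<le> (A 1)\<^sup>2 + K * ((\<Sum>j\<le>m. (A (Suc j))\<^sup>2) - (A 1)\<^sup>2 / 2 - (A (Suc m))\<^sup>2 / 2)"
  proof (induction m)
    case 0
    then show ?case by (simp add: energy_def B_def)
  next
    case (Suc m)
    have "A (Suc m) * A (Suc (Suc m)) \<le> (A (Suc m))\<^sup>2 / 2 + (A (Suc (Suc m)))\<^sup>2 / 2"
      using sum_squares_bound[of "A (Suc m)" "A (Suc (Suc m))"] by simp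
    from mult_left_mono[OF this K_nonneg]
    have "K * A (Suc m) * A (Suc (Suc m)) \<le> K * ((A (Suc m))\<^sup>2 / 2 + (A (Suc (Suc m)))\<^sup>2 / 2)"
      by (simp add: mult.assoc)
    with Suc show ?case
      unfolding energy_Suc by (simp add: algebra_simps)
  qed
  moreover have "(\<Sum>j\<le>m. (A (Suc j))\<^sup>2) \<le> 1"
  proof -
    have "(A 0)\<^sup>2 + (\<Sum>j\<le>m. (A (Suc j))\<^sup>2) \<le> 1"
      using square_sum_le_1[of "Suc m"] by (simp add: sum.atMost_Suc_shift del: sum.atMost_Suc)
    then show ?thesis
      using zero_le_power2[of "A 0"] by linarith
  qed
  then have "K * ((\<Sum>j\<le>m. (A (Suc j))\<^sup>2) - (A 1)\<^sup>2 / 2 - (A (Suc m))\<^sup>2 / 2) \<le> K * 1"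
    using zero_le_power2[of "A 1"] zero_le_power2[of "A (Suc m)"]
    by (intro mult_left_mono K_nonneg) linarith
  moreover have "(A 1)\<^sup>2 \<le> 1"
    using abs_A_le_1[of 1] by (simp add: abs_square_le_1)
  ultimately show ?thesis
    by linarith
qed

lemma jump_square: "(jump m)\<^sup>2 = 4 * energy m + ((x m)\<^sup>2 - 4) * (B (Suc m))\<^sup>2"
  unfolding jump_def energy_def B_rec[of m] by (simp add: power2_eq_square algebra_simps)

text \<open>In \<open>jump_square\<close> the second term is nonpositive in the oscillating range. Slightly outside it is
  still harmless: an excess of \<open>\<bar>x\<bar>\<close> over 2 of order \<open>1/m\<close>, against \<open>B\<^sup>2 \<le> m\<^sup>2\<close>, costs a multiple
  of \<open>m\<close>. Consecutive coefficients differ by \<open>O(1/m)\<close> near the turning points, so this covers the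
  first or last index outside the range.\<close>

lemma near_turning_point:
  assumes x: "\<bar>x m\<bar> - 2 \<le> (s + 2) / real (Suc m)" and K: "K \<le> 2 * (s + 2) * real (Suc m)"
  shows "(jump m)\<^sup>2 \<le> D * real (Suc m)"
proof -
  let ?n = "real (Suc m)"
  have n: "1 \<le> ?n" by simp
  have "((x m)\<^sup>2 - 4) * (B (Suc m))\<^sup>2 \<le> (s + 2) * (s + 6) * ?n"
  proof (cases "\<bar>x m\<bar> \<le> 2")
    case True
    then have "(x m)\<^sup>2 \<le> 2\<^sup>2"
      by (metis abs_le_square_iff abs_numeral)
    then have "((x m)\<^sup>2 - 4) * (B (Suc m))\<^sup>2 \<le> 0"
      by (intro mult_nonpos_nonneg) auto
    also have "0 \<le> (s + 2) * (s + 6) * ?n"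
      using s_gt_2 by simp
    finally show ?thesis .
  next
    case False
    have "(s + 2) / ?n \<le> s + 2"
      using s_gt_2 n by (simp add: divide_le_eq mult_left_le)
    then have "\<bar>x m\<bar> + 2 \<le> s + 6"
      using x by linarith
    then have "(\<bar>x m\<bar> - 2) * (\<bar>x m\<bar> + 2) \<le> (s + 2) / ?n * (s + 6)"
      using False x s_gt_2 by (intro mult_mono) auto
    then have le: "(x m)\<^sup>2 - 4 \<le> (s + 2) / ?n * (s + 6)"
      by (simp add: algebra_simps power2_eq_square flip: abs_mult)
    have "((x m)\<^sup>2 - 4) * (B (Suc m))\<^sup>2 \<le> (s + 2) / ?n * (s + 6) * ?n\<^sup>2"
      using s_gt_2 by (intro mult_mono le B_square_le) auto
    also have "\<dots> = (s + 2) * (s + 6) * ?n"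
      by (simp add: power2_eq_square del: of_nat_Suc)
    finally show ?thesis .
  qed
  moreover have "4 * energy m \<le> 4 * ?n + 4 * (2 * (s + 2) * ?n)"
  proof -
    have "energy m \<le> ?n + 2 * (s + 2) * ?n"
      by (rule order_trans[OF energy_le add_mono[OF n K]])
    from mult_left_mono[OF this, of 4] show ?thesis
      by (simp only: distrib_left)
  qed
  ultimately have "(jump m)\<^sup>2 \<le> (s + 2) * (s + 6) * ?n + (4 * ?n + 4 * (2 * (s + 2) * ?n))"
    unfolding jump_square by linarith
  also have "\<dots> = D * ?n"
    by (simp add: D_def power2_eq_square algebra_simps)
  finally show ?thesis .
qed

lemma growth_region:
  assumes "2 \<le> x m"
  shows "0 \<le> B m \<and> B m \<le> B (Suc m) \<and> B (Suc m) \<le> B (Suc (Suc m))"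
  using assms
proof (induction m)
  case 0
  have "0 \<le> B (Suc 0)"
    using A1_nonneg by (simp add: B_def)
  moreover from this have "2 * B (Suc 0) \<le> x 0 * B (Suc 0)"
    using 0 by (intro mult_right_mono)
  ultimately show ?case
    using B_rec[of 0] by simp
next
  case (Suc m)
  have "2 \<le> x m"
    using Suc.prems x_antimono[of m "Suc m"] by simp
  note IH = Suc.IH[OF this]
  have "2 * B (Suc (Suc m)) \<le> x (Suc m) * B (Suc (Suc m))"
    using IH Suc.prems by (intro mult_right_mono) auto
  with IH show ?case
    using B_rec[of "Suc m"] by linarith
qed

text \<open>The increase of the jump dominates \<open>(x - 2) B\<close>, and \<open>B\<close> dominates the previous jump. The factor
  \<open>x - 1\<close> is at least 1, which gives monotonicity, and at least 2 once \<open>x \<ge> 3\<close>.\<close>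

lemma growth_region_jump:
  assumes "2 \<le> x (Suc m)"
  shows "0 \<le> jump m \<and> (x (Suc m) - 1) * jump m \<le> jump (Suc m)"
proof -
  have x: "2 \<le> x m"
    using assms x_antimono[of m "Suc m"] by simp
  note g = growth_region[OF x]
  have jump: "0 \<le> jump m" "jump m \<le> B (Suc (Suc m))"
    using g by (auto simp: jump_def)
  have "jump (Suc m) - jump m = (x (Suc m) - 2) * B (Suc (Suc m)) + (x m - 2) * B (Suc m)"
    unfolding jump_def B_rec[of "Suc m"] B_rec[of m] by (simp add: algebra_simps)
  moreover have "(x (Suc m) - 2) * jump m \<le> (x (Suc m) - 2) * B (Suc (Suc m))"
    using assms jump by (intro mult_left_mono) auto
  moreover have "0 \<le> (x m - 2) * B (Suc m)"
    using x g by (intro mult_nonneg_nonneg) auto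
  ultimately have "(x (Suc m) - 2) * jump m \<le> jump (Suc m) - jump m"
    by linarith
  then show ?thesis
    using jump by (simp add: algebra_simps)
qed

lemma growth_region_jump_mono:
  assumes "m \<le> n" "2 \<le> x n"
  shows "0 \<le> jump m \<and> jump m \<le> jump n"
  using assms
proof (induction n rule: dec_induct)
  case base
  then show ?case
    using growth_region[of m] by (auto simp: jump_def)
next
  case (step n)
  have "2 \<le> x n"
    using step.prems x_antimono[of n "Suc n"] by simp
  note IH = step.IH[OF this]
  have jump: "0 \<le> jump n" "(x (Suc n) - 1) * jump n \<le> jump (Suc n)"
    using growth_region_jump[OF step.prems] by auto
  have "1 * jump n \<le> (x (Suc n) - 1) * jump n"
    using step.prems jump by (intro mult_right_mono) auto
  with jump IH show ?case
    by linarith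
qed

text \<open>Let \<open>J\<close> be the last index with \<open>x \<ge> 2\<close>, where \<open>near_turning_point\<close> applies. Monotonicity alone
  gives a bound by \<open>J\<close>, which is too weak if \<open>J\<close> is much larger than \<open>m\<close>. The induction runs
  downwards from \<open>J\<close>: as long as \<open>x < 3\<close> the indices \<open>m\<close> and \<open>J\<close> are comparable, and where
  \<open>x \<ge> 3\<close> every step down halves the jump, which more than compensates for the smaller index.\<close>

lemma jump_square_le_growth:
  assumes "2 \<le> x m"
  shows "(jump m)\<^sup>2 \<le> 4 * D * real (Suc m)"
proof -
  have D: "0 \<le> D"
    using s_gt_2 by (simp add: D_def)
  have x_iff: "c \<le> x j \<longleftrightarrow> (s + c) * real (Suc j) \<le> K" for c j
    unfolding x_def by (simp add: field_simps)
  define S where "S = {j. 2 \<le> x j}"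
  have "S \<subseteq> {..nat \<lfloor>K\<rfloor>}"
  proof
    fix j assume "j \<in> S"
    then have "(s + 2) * real (Suc j) \<le> K"
      by (simp add: S_def x_iff)
    moreover have "real j \<le> real (Suc j)" "1 * real (Suc j) \<le> (s + 2) * real (Suc j)"
      using s_gt_2 by (auto intro: mult_right_mono)
    ultimately have "real j \<le> K"
      by (simp only: mult_1)
    then show "j \<in> {..nat \<lfloor>K\<rfloor>}"
      by (simp add: le_nat_iff le_floor_iff)
  qed
  then have fin: "finite S"
    using finite_subset by blast
  have "m \<in> S"
    using assms by (simp add: S_def)
  define J where "J = Max S"
  have J: "2 \<le> x J" and mJ: "m \<le> J"
    using Max_in[OF fin] Max_ge[OF fin \<open>m \<in> S\<close>] \<open>m \<in> S\<close> by (auto simp: J_def S_def)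
  have "Suc J \<notin> S"
    using Max_ge[OF fin, of "Suc J"] by (auto simp: J_def)
  then have KJ: "K < (s + 2) * real (Suc (Suc J))"
    by (simp add: S_def x_iff not_le)
  have UJ: "(jump J)\<^sup>2 \<le> D * real (Suc J)"
  proof (rule near_turning_point)
    have "x J - 2 = (K - (s + 2) * real (Suc J)) / real (Suc J)"
      by (simp add: x_def field_simps)
    also have "\<dots> \<le> (s + 2) / real (Suc J)"
      using KJ by (intro divide_right_mono) (auto simp: algebra_simps)
    finally show "\<bar>x J\<bar> - 2 \<le> (s + 2) / real (Suc J)"
      using J by simp
    have "(s + 2) * real (Suc (Suc J)) \<le> (s + 2) * (2 * real (Suc J))"
      using s_gt_2 by (intro mult_left_mono) auto
    then show "K \<le> 2 * (s + 2) * real (Suc J)"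
      using KJ by linarith
  qed
  show ?thesis
    using mJ
  proof (induction m rule: inc_induct)
    case base
    have "D * real (Suc J) \<le> 4 * D * real (Suc J)"
      using D by (simp add: mult_right_mono)
    with UJ show ?case
      by linarith
  next
    case (step m)
    have xm: "2 \<le> x (Suc m)"
      using J x_antimono[of "Suc m" J] step.hyps by simp
    have Um: "0 \<le> jump m" "(x (Suc m) - 1) * jump m \<le> jump (Suc m)"
      using growth_region_jump[OF xm] by auto
    show ?case
    proof (cases "3 \<le> x (Suc m)")
      case True
      have "2 * jump m \<le> (x (Suc m) - 1) * jump m"
        using True Um by (intro mult_right_mono) auto
      then have "2 * jump m \<le> jump (Suc m)"
        using Um by linarith
      then have "(2 * jump m)\<^sup>2 \<le> (jump (Suc m))\<^sup>2"
        using Um by (intro power_mono) auto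
      then have "4 * (jump m)\<^sup>2 \<le> 4 * D * real (Suc (Suc m))"
        using step.IH by (simp add: power_mult_distrib)
      also have "\<dots> \<le> 4 * D * (4 * real (Suc m))"
        using D by (intro mult_left_mono) auto
      finally show ?thesis by (simp add: algebra_simps)
    next
      case False
      have "(s + 2) * real (Suc J) \<le> (s + 3) * real (Suc (Suc m))"
        using False J by (simp add: x_iff)
      also have "\<dots> \<le> (s + 2) * (4 * real (Suc m))"
      proof -
        have "(s + 3) * real (Suc (Suc m)) \<le> ((s + 2) * 2) * (2 * real (Suc m))"
          using s_gt_2 by (intro mult_mono) auto
        then show ?thesis by (simp add: algebra_simps)
      qed
      finally have "real (Suc J) \<le> 4 * real (Suc m)"
        using s_gt_2 by (simp only: mult_le_cancel_left_pos)
      from mult_left_mono[OF this D] have "D * real (Suc J) \<le> 4 * D * real (Suc m)"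
        by (simp add: algebra_simps)
      moreover have "(jump m)\<^sup>2 \<le> (jump J)\<^sup>2"
        using growth_region_jump_mono[OF _ J, of m] step.hyps by (intro power_mono) auto
      ultimately show ?thesis
        using UJ by linarith
    qed
  qed
qed

text \<open>The recurrence also has solutions that grow here. If \<open>\<bar>B\<bar>\<close> increased once, it would keep
  increasing by at least the same amount at each step, so \<open>\<bar>A\<^sub>i\<bar>\<close> would stay away from 0, against
  the summability of its squares.\<close>

lemma decay_region:
  assumes "x m \<le> -2"
  shows "\<bar>B (Suc m)\<bar> \<le> \<bar>B m\<bar>"
proof (rule ccontr)
  assume contr: "\<not> ?thesis"
  define d where "d = \<bar>B (Suc m)\<bar> - \<bar>B m\<bar>"
  have d: "0 < d"
    using contr by (simp add: d_def)
  have incr: "d \<le> \<bar>B (Suc (m + i))\<bar> - \<bar>B (m + i)\<bar>" for i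
  proof (induction i)
    case 0
    then show ?case by (simp add: d_def)
  next
    case (Suc i)
    have "x (m + i) \<le> -2"
      using assms x_antimono[of m "m + i"] by simp
    then have "2 * \<bar>B (Suc (m + i))\<bar> \<le> \<bar>x (m + i)\<bar> * \<bar>B (Suc (m + i))\<bar>"
      by (intro mult_right_mono) auto
    then have "2 * \<bar>B (Suc (m + i))\<bar> \<le> \<bar>B (Suc (Suc (m + i)))\<bar> + \<bar>B (m + i)\<bar>"
      using B_rec[of "m + i"] by (simp add: abs_mult[symmetric])
    with Suc show ?case by simp
  qed
  have lower: "real i * d \<le> \<bar>B (m + i)\<bar>" for i
  proof (induction i)
    case (Suc i)
    then show ?case using incr[of i] by (simp add: algebra_simps)
  qed simp
  have A_lower: "d / 2 \<le> \<bar>A (m + i)\<bar>" if "Suc m \<le> i" for i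
  proof -
    have "real (m + i) * (d / 2) \<le> real i * d"
      using that d by (simp add: algebra_simps)
    also have "\<dots> \<le> real (m + i) * \<bar>A (m + i)\<bar>"
      using lower[of i] by (simp add: B_def abs_mult)
    finally show ?thesis
      using that by (simp only: mult_le_cancel_left)
  qed
  obtain N :: nat where N: "1 < real N * (d / 2)\<^sup>2"
    using reals_Archimedean3[of "(d / 2)\<^sup>2"] d by auto
  let ?I = "{m + Suc m..<m + Suc m + N}"
  have "real N * (d / 2)\<^sup>2 = (\<Sum>j\<in>?I. (d / 2)\<^sup>2)"
    by simp
  also have "\<dots> \<le> (\<Sum>j\<in>?I. (A j)\<^sup>2)"
  proof (rule sum_mono)
    fix j assume "j \<in> ?I"
    then have "d / 2 \<le> \<bar>A j\<bar>"
      using A_lower[of "j - m"] by auto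
    then have "(d / 2)\<^sup>2 \<le> \<bar>A j\<bar>\<^sup>2"
      using d by (intro power_mono) auto
    then show "(d / 2)\<^sup>2 \<le> (A j)\<^sup>2" by simp
  qed
  also have "\<dots> \<le> (\<Sum>j\<le>m + Suc m + N. (A j)\<^sup>2)"
    by (rule sum_mono2) auto
  also have "\<dots> \<le> 1"
    by (rule square_sum_le_1)
  finally show False
    using N by simp
qed

text \<open>Up to the alternating sign, \<open>B\<close> is convex and decreasing here, so its differences over two steps
  decrease.\<close>

lemma decay_region_jump:
  assumes "x m \<le> -2"
  shows "\<bar>jump (Suc m)\<bar> \<le> \<bar>jump m\<bar>"
proof -
  have x': "x (Suc m) \<le> -2" "x (Suc (Suc m)) \<le> -2"
    using assms x_antimono[of m "Suc m"] x_antimono[of m "Suc (Suc m)"] by auto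
  have step: "\<bar>d - b\<bar> \<le> \<bar>c - a\<bar>"
    if ab: "\<bar>b\<bar> \<le> \<bar>a\<bar>" and bc: "\<bar>c\<bar> \<le> \<bar>b\<bar>" and cd: "\<bar>d\<bar> \<le> \<bar>c\<bar>"
      and r1: "c = x m * b - a" and r2: "d = x (Suc m) * c - b" and b: "0 \<le> b"
    for a b c d
  proof -
    define P where "P = (x m + 2) * b"
    define Q where "Q = (x (Suc m) + 2) * c"
    have c: "c + a = P - 2 * b" and d: "d + b = Q - 2 * c"
      using r1 r2 by (auto simp: P_def Q_def algebra_simps)
    have P: "P \<le> 0"
      unfolding P_def using assms b by (intro mult_nonpos_nonneg) auto
    have c_abs: "- b \<le> c" "c \<le> b" and a: "a \<le> - b"
      using bc b c P by linarith+
    have c0: "c \<le> 0"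
    proof (rule ccontr)
      assume *: "\<not> c \<le> 0"
      then have "Q \<le> 0"
        unfolding Q_def using x' by (intro mult_nonpos_nonneg) auto
      then show False using d cd c_abs * by linarith
    qed
    have "0 \<le> Q"
      unfolding Q_def using x' c0 by (intro mult_nonpos_nonpos) auto
    then show ?thesis
      using a c0 c d P c_abs cd b by linarith
  qed
  have "\<bar>B (Suc (Suc m))\<bar> \<le> \<bar>B (Suc m)\<bar>" "\<bar>B (Suc m)\<bar> \<le> \<bar>B m\<bar>"
    "\<bar>B (Suc (Suc (Suc m)))\<bar> \<le> \<bar>B (Suc (Suc m))\<bar>"
    using decay_region assms x' by auto
  note abs = this
  show ?thesis
  proof (cases "0 \<le> B (Suc m)")
    case True
    show ?thesis
      unfolding jump_def by (rule step[OF abs(2,1,3) B_rec B_rec True])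
  next
    case False
    have "- B (Suc (Suc m)) = x m * - B (Suc m) - - B m"
      "- B (Suc (Suc (Suc m))) = x (Suc m) * - B (Suc (Suc m)) - - B (Suc m)"
      using B_rec[of m] B_rec[of "Suc m"] by (simp_all only: mult_minus_right)
    with False abs have "\<bar>- B (Suc (Suc (Suc m))) - - B (Suc m)\<bar> \<le> \<bar>- B (Suc (Suc m)) - - B m\<bar>"
      by (intro step) auto
    then show ?thesis
      unfolding jump_def by linarith
  qed
qed

text \<open>The jump at \<open>m\<close> is at most the jump at the first index \<open>J\<close> with \<open>x \<le> -2\<close>, to which
  \<open>near_turning_point\<close> applies.\<close>

lemma jump_square_le_decay:
  assumes "x m \<le> -2"
  shows "(jump m)\<^sup>2 \<le> D * real (Suc m)"
proof -
  have D: "0 \<le> D"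
    using s_gt_2 by (simp add: D_def)
  have x_iff: "x j \<le> -2 \<longleftrightarrow> K \<le> (s - 2) * real (Suc j)" for j
    unfolding x_def by (simp add: field_simps)
  define J where "J = (LEAST j. x j \<le> -2)"
  have J: "x J \<le> -2" and Jm: "J \<le> m"
    unfolding J_def using assms by (auto intro: LeastI Least_le)
  have KJ: "(s - 2) * real J \<le> K"
  proof (cases J)
    case (Suc j)
    then have "\<not> x j \<le> -2"
      unfolding J_def using not_less_Least[of j "\<lambda>j. x j \<le> -2"] by auto
    then show ?thesis
      using Suc by (simp add: x_iff)
  qed (simp add: K_nonneg)
  have "(jump J)\<^sup>2 \<le> D * real (Suc J)"
  proof (rule near_turning_point)
    have "- x J - 2 = ((s - 2) * real (Suc J) - K) / real (Suc J)"
      by (simp add: x_def field_simps)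
    also have "\<dots> \<le> (s + 2) / real (Suc J)"
      using KJ by (intro divide_right_mono) (auto simp: algebra_simps)
    finally show "\<bar>x J\<bar> - 2 \<le> (s + 2) / real (Suc J)"
      using J by simp
    have "K \<le> (s - 2) * real (Suc J)"
      using J by (simp add: x_iff)
    also have "\<dots> \<le> (2 * (s + 2)) * real (Suc J)"
      using s_gt_2 by (intro mult_right_mono) auto
    finally show "K \<le> 2 * (s + 2) * real (Suc J)" .
  qed
  moreover have "\<bar>jump m\<bar> \<le> \<bar>jump J\<bar>"
    using Jm
  proof (induction m rule: dec_induct)
    case (step n)
    have "x n \<le> -2"
      using J x_antimono[of J n] step.hyps by simp
    from decay_region_jump[OF this] step.IH show ?case
      by linarith
  qed simp
  then have "(jump m)\<^sup>2 \<le> (jump J)\<^sup>2"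
    by (simp add: abs_le_square_iff)
  moreover have "D * real (Suc J) \<le> D * real (Suc m)"
    using Jm D by (intro mult_left_mono) auto
  ultimately show ?thesis
    by linarith
qed

lemma jump_square_le: "(jump m)\<^sup>2 \<le> 4 * D * real (Suc m)"
proof -
  have D: "0 \<le> D"
    using s_gt_2 by (simp add: D_def)
  then have *: "D * real (Suc m) \<le> 4 * D * real (Suc m)"
    by (intro mult_right_mono) auto
  consider "2 \<le> x m" | "x m \<le> -2" | "\<bar>x m\<bar> < 2"
    by linarith
  then show ?thesis
  proof cases
    case 1
    then show ?thesis by (rule jump_square_le_growth)
  next
    case 2
    from jump_square_le_decay[OF this] * show ?thesis
      by linarith
  next
    case 3
    have "(jump m)\<^sup>2 \<le> D * real (Suc m)"
    proof (rule near_turning_point)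
      show "\<bar>x m\<bar> - 2 \<le> (s + 2) / real (Suc m)"
        using 3 s_gt_2 divide_nonneg_nonneg[of "s + 2" "real (Suc m)"] by linarith
      have "K < (s + 2) * real (Suc m)"
        using 3 by (simp add: x_def field_simps)
      moreover have "0 \<le> (s + 2) * real (Suc m)"
        using s_gt_2 by simp
      ultimately show "K \<le> 2 * (s + 2) * real (Suc m)"
        by linarith
    qed
    with * show ?thesis
      by linarith
  qed
qed

lemma difference_bound: "\<bar>A (Suc (Suc m)) - A m\<bar> \<le> (2 * sqrt D + 2) / sqrt (real (Suc m))"
proof -
  let ?n = "real (Suc m)"
  have "\<bar>jump m\<bar> \<le> 2 * sqrt D * sqrt ?n"
    using real_sqrt_le_mono[OF jump_square_le[of m]] by (simp add: real_sqrt_mult)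
  \<comment> \<open>The weights in the jump differ from \<open>m + 1\<close> by one each.\<close>
  moreover have "?n * (A (Suc (Suc m)) - A m) = jump m - A (Suc (Suc m)) - A m"
    by (simp add: jump_def B_def algebra_simps)
  ultimately have "\<bar>?n * (A (Suc (Suc m)) - A m)\<bar> \<le> 2 * sqrt D * sqrt ?n + 2"
    using abs_A_le_1[of m] abs_A_le_1[of "Suc (Suc m)"] by linarith
  then have "?n * \<bar>A (Suc (Suc m)) - A m\<bar> \<le> 2 * sqrt D * sqrt ?n + 2"
    by (simp only: abs_mult abs_of_nat)
  also have "\<dots> \<le> (2 * sqrt D + 2) * sqrt ?n"
    by (simp add: algebra_simps)
  also have "?n * \<bar>A (Suc (Suc m)) - A m\<bar> = sqrt ?n * sqrt ?n * \<bar>A (Suc (Suc m)) - A m\<bar>"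
    by (simp only: real_sqrt_mult_self abs_of_nat)
  finally have "sqrt ?n * \<bar>A (Suc (Suc m)) - A m\<bar> * sqrt ?n \<le> (2 * sqrt D + 2) * sqrt ?n"
    by (simp only: mult_ac)
  then have "sqrt ?n * \<bar>A (Suc (Suc m)) - A m\<bar> \<le> 2 * sqrt D + 2"
    by (rule mult_right_le_imp_le) simp
  then show ?thesis
    by (simp add: pos_le_divide_eq mult.commute del: of_nat_Suc)
qed

end

section \<open>Powers of a Blaschke factor as power series\<close>

unbundle no vec_syntax
no_notation vec_index (infixl \<open>$\<close> 100)
unbundle fps_syntax

text \<open>The Blaschke factor of the disc is the case \<open>b = cnj a\<close>. With two parameters the definition makes
  sense over any field; it is used over \<open>\<real>\<close> with \<open>b = a\<close>, and over \<open>\<complex>\<close>.\<close>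

definition blaschke :: "'a::field \<Rightarrow> 'a \<Rightarrow> 'a fps" where
  "blaschke a b = (fps_const a + fps_X) * inverse (1 + fps_const b * fps_X)"

lemma denominator_mult_blaschke:
  "(1 + fps_const b * fps_X) * blaschke a b = fps_const a + fps_X"
proof -
  have "inverse (1 + fps_const b * fps_X) * (1 + fps_const b * fps_X) = (1 :: 'a fps)"
    by (rule inverse_mult_eq_1) simp
  then show ?thesis
    unfolding blaschke_def by (simp add: mult_ac)
qed

lemma blaschke_mult_nth:
  fixes F :: "'a::field fps"
  shows "(blaschke a b * F) $ 0 = a * F $ 0"
    and "(blaschke a b * F) $ Suc m = a * F $ Suc m + F $ m - b * (blaschke a b * F) $ m"
proof -
  have eq: "(1 + fps_const b * fps_X) * (blaschke a b * F) = (fps_const a + fps_X) * F"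
    by (simp only: mult.assoc[symmetric] denominator_mult_blaschke)
  have l: "(1 + fps_const b * fps_X) * (blaschke a b * F)
      = blaschke a b * F + fps_const b * (fps_X * (blaschke a b * F))"
    by (simp only: distrib_right mult_1 mult.assoc)
  have r: "(fps_const a + fps_X) * F = fps_const a * F + fps_X * F"
    by (simp only: distrib_right)
  have nth: "(blaschke a b * F + fps_const b * (fps_X * (blaschke a b * F))) $ i
      = (fps_const a * F + fps_X * F) $ i" for i
    using eq unfolding l r by simp
  show "(blaschke a b * F) $ 0 = a * F $ 0"
    using nth[of 0] by (simp del: fps_mult_nth_0)
  show "(blaschke a b * F) $ Suc m = a * F $ Suc m + F $ m - b * (blaschke a b * F) $ m"
    using nth[of "Suc m"] by (simp add: eq_diff_eq)
qed

lemma blaschke_nth: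
  fixes a b :: "'a::field"
  shows "blaschke a b $ 0 = a" "blaschke a b $ Suc m = (- b) ^ m * (1 - b * a)"
proof -
  show "blaschke a b $ 0 = a"
    using blaschke_mult_nth(1)[of a b 1] by simp
  moreover have "blaschke a b $ Suc m = 1 $ m - b * blaschke a b $ m" for m
    using blaschke_mult_nth(2)[of a b 1 m] by simp
  ultimately show "blaschke a b $ Suc m = (- b) ^ m * (1 - b * a)"
    by (induction m) simp_all
qed

text \<open>Multiplication by a Blaschke factor is an isometry of \<open>\<ell>\<^sup>2\<close>. The second summand on the left is
  the part of the input energy that is stored at time \<open>m\<close> and has not yet been returned.\<close>

lemma blaschke_mult_energy:
  fixes r :: real and F :: "real fps"
  assumes "r\<^sup>2 < 1"
  defines "G \<equiv> blaschke r r * F"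
  shows "(\<Sum>j\<le>m. (G $ j)\<^sup>2) + (F $ m - r * G $ m)\<^sup>2 / (1 - r\<^sup>2) = (\<Sum>j\<le>m. (F $ j)\<^sup>2)"
proof -
  have step: "(r * f + d)\<^sup>2 + (f - r * (r * f + d))\<^sup>2 / (1 - r\<^sup>2) = f\<^sup>2 + d\<^sup>2 / (1 - r\<^sup>2)" for f d
    using assms(1) by (simp add: divide_simps) (simp add: power2_eq_square algebra_simps)
  show ?thesis
  proof (induction m)
    case 0
    then show ?case
      using step[of "F $ 0" 0] by (simp add: G_def blaschke_nth)
  next
    case (Suc m)
    have "G $ Suc m = r * F $ Suc m + (F $ m - r * G $ m)"
      by (simp add: G_def blaschke_mult_nth)
    then show ?case
      using Suc step[of "F $ Suc m" "F $ m - r * G $ m"] by simp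
  qed
qed

lemma blaschke_power_square_sum:
  fixes r :: real and k :: nat
  assumes "r\<^sup>2 < 1"
  shows "(\<Sum>j\<le>m. ((blaschke r r ^ k) $ j)\<^sup>2) \<le> 1"
proof (induction k)
  case 0
  have "(\<Sum>j\<le>m. ((1 :: real fps) $ j)\<^sup>2) = (\<Sum>j\<le>m. if j = 0 then 1 else 0)"
    by (intro sum.cong) auto
  then show ?case by simp
next
  case (Suc k)
  have rest: "0 \<le> (c :: real)\<^sup>2 / (1 - r\<^sup>2)" for c
    using assms by simp
  then show ?case
    unfolding power_Suc
    using Suc blaschke_mult_energy[OF assms, of "blaschke r r ^ k" m]
      rest[of "blaschke r r ^ k $ m - r * (blaschke r r * blaschke r r ^ k) $ m"] by linarith
qed

text \<open>The logarithmic derivative of \<open>(r + X) / (1 + r X)\<close> is \<open>(1 - r\<^sup>2) / ((r + X) (1 + r X))\<close>.\<close>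

lemma blaschke_power_deriv:
  fixes r :: real and k :: nat
  defines "F \<equiv> blaschke r r ^ k"
  shows "(fps_const r + fps_const (1 + r\<^sup>2) * fps_X + fps_const r * fps_X\<^sup>2) * fps_deriv F
           = fps_const (real k * (1 - r\<^sup>2)) * F"
proof -
  let ?b = "blaschke r r" and ?q = "1 + fps_const r * fps_X :: real fps"
  have q: "?q * ?b = fps_const r + fps_X"
    by (rule denominator_mult_blaschke)
  have "fps_deriv (?q * ?b) = 1"
    unfolding q by simp
  then have "fps_const r * ?b + ?q * fps_deriv ?b = 1"
    by (simp add: algebra_simps)
  then have "fps_const r * (?q * ?b) + ?q * ?q * fps_deriv ?b = ?q"
    by (metis (no_types, opaque_lifting) distrib_left mult.assoc mult.commute mult.right_neutral)
  then have db: "?q * ?q * fps_deriv ?b = fps_const (1 - r\<^sup>2)"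
    unfolding q by (simp add: algebra_simps power2_eq_square flip: fps_const_mult fps_const_sub)
  have "?q * ((fps_const r + fps_X) * ?q * fps_deriv F)
      = fps_const (real k) * (?q * ?q * fps_deriv ?b) * (?b ^ (k - 1) * (?q * ?b))"
    unfolding F_def fps_deriv_power q[symmetric] by (simp only: mult_ac)
  also have "\<dots> = fps_const (real k * (1 - r\<^sup>2)) * (?q * (?b ^ (k - 1) * ?b))"
    unfolding db by (simp only: fps_const_mult[symmetric] mult_ac)
  also have "\<dots> = ?q * (fps_const (real k * (1 - r\<^sup>2)) * F)"
    unfolding F_def by (cases k) (simp_all add: mult_ac del: fps_const_mult)
  finally have "(fps_const r + fps_X) * ?q * fps_deriv F = fps_const (real k * (1 - r\<^sup>2)) * F"
    by (subst (asm) mult_cancel_left) (auto simp: fps_eq_iff dest: spec[of _ 0])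
  moreover have "(fps_const r + fps_X) * ?q
      = fps_const r + fps_const (1 + r\<^sup>2) * fps_X + fps_const r * fps_X\<^sup>2"
    by (simp add: algebra_simps power2_eq_square flip: fps_const_mult fps_const_add)
  ultimately show ?thesis
    by simp
qed

lemma blaschke_power_recurrence:
  fixes r :: real and k :: nat
  defines "F \<equiv> blaschke r r ^ k"
  shows "r * (real (Suc (Suc m)) * F $ Suc (Suc m)) + r * (real m * F $ m)
           = (real k * (1 - r\<^sup>2) - (1 + r\<^sup>2) * real (Suc m)) * F $ Suc m"
    and "r * F $ 1 = real k * (1 - r\<^sup>2) * F $ 0"
proof -
  let ?d = "fps_deriv F"
  have "fps_const r * ?d + fps_const (1 + r\<^sup>2) * (fps_X * ?d) + fps_const r * (fps_X * (fps_X * ?d))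
      = fps_const (real k * (1 - r\<^sup>2)) * F"
    using blaschke_power_deriv[of r k, folded F_def] by (simp only: distrib_right power2_eq_square mult.assoc)
  then have nth: "r * ?d $ i + (1 + r\<^sup>2) * (fps_X * ?d) $ i + r * (fps_X * (fps_X * ?d)) $ i
      = real k * (1 - r\<^sup>2) * F $ i" for i
    by (metis fps_add_nth fps_mult_left_const_nth)
  show "r * F $ 1 = real k * (1 - r\<^sup>2) * F $ 0"
    using nth[of 0] by simp
  show "r * (real (Suc (Suc m)) * F $ Suc (Suc m)) + r * (real m * F $ m)
           = (real k * (1 - r\<^sup>2) - (1 + r\<^sup>2) * real (Suc m)) * F $ Suc m"
    using nth[of "Suc m"] by (cases m) (simp_all add: algebra_simps)
qed

lemma blaschke_power_difference_bound:
  fixes r :: real and k :: nat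
  assumes "0 < r" "r < 1"
  obtains C where "0 < C"
    "\<And>k m. \<bar>(blaschke r r ^ k) $ Suc (Suc m) - (blaschke r r ^ k) $ m\<bar> \<le> C / sqrt (real (Suc m))"
proof -
  define s where "s = (1 + r\<^sup>2) / r"
  have r2: "r\<^sup>2 < 1"
    using assms by (simp add: power_less_one_iff)
  have s: "2 < s"
  proof -
    have "0 < (1 - r)\<^sup>2"
      using assms by simp
    then show ?thesis
      unfolding s_def using assms by (simp add: less_divide_eq power2_eq_square algebra_simps)
  qed
  have rec: "turning_point_recurrence (\<lambda>m. (blaschke r r ^ k) $ m) (real k * (1 - r\<^sup>2) / r) s" for k
  proof
    show "2 < s" by (rule s)
    show "0 \<le> real k * (1 - r\<^sup>2) / r"
      using assms r2 by simp
    have F0: "(blaschke r r ^ k) $ 0 = r ^ k"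
      by (simp add: fps_power_zeroth blaschke_nth)
    have "(blaschke r r ^ k) $ 1 = real k * (1 - r\<^sup>2) * r ^ k / r"
      using blaschke_power_recurrence(2)[of r k] assms unfolding F0 by (simp add: field_simps)
    then show "0 \<le> (blaschke r r ^ k) $ 1"
      using assms r2 by simp
    show "(\<Sum>j\<le>m. ((blaschke r r ^ k) $ j)\<^sup>2) \<le> 1" for m
      by (rule blaschke_power_square_sum[OF r2])
    show "real (Suc (Suc m)) * (blaschke r r ^ k) $ Suc (Suc m) + real m * (blaschke r r ^ k) $ m
        = (real k * (1 - r\<^sup>2) / r - s * real (Suc m)) * (blaschke r r ^ k) $ Suc m" for m
    proof -
      have "real k * (1 - r\<^sup>2) / r - s * real (Suc m)
          = (real k * (1 - r\<^sup>2) - (1 + r\<^sup>2) * real (Suc m)) / r"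
        unfolding s_def using assms by (simp add: field_simps)
      then show ?thesis
        using blaschke_power_recurrence(1)[of r m k] assms by (simp add: field_simps)
    qed
  qed
  have "0 < 2 * sqrt (turning_point_recurrence.D s) + 2"
    using turning_point_recurrence.D_def[OF rec[of 0]] s by (simp add: add_nonneg_pos)
  then show thesis
    using turning_point_recurrence.difference_bound[OF rec] by (rule that)
qed

text \<open>This is \<open>\<phi>\<^sub>z(u w) = u \<phi>\<^sub>r(w)\<close>, which reduces complex parameters to real ones.\<close>

lemma blaschke_power_rotate:
  fixes r :: real and u :: complex
  assumes u: "cmod u = 1" and z: "z = complex_of_real r * u"
  shows "(blaschke z (cnj z) ^ k) $ m = u ^ k * cnj u ^ m * complex_of_real ((blaschke r r ^ k) $ m)"
proof (induction k arbitrary: m)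
  case 0
  then show ?case by simp
next
  case (Suc k)
  note IHk = Suc
  have uu: "u * cnj u = 1"
    using u by (simp add: complex_norm_square[symmetric])
  show ?case
  proof (induction m)
    case 0
    have "(blaschke z (cnj z) ^ Suc k) $ 0 = z * (u ^ k * cnj u ^ 0 * complex_of_real ((blaschke r r ^ k) $ 0))"
      by (simp only: power_Suc blaschke_mult_nth(1) IHk)
    then show ?case
      by (simp add: blaschke_nth z)
  next
    case (Suc m)
    have "(blaschke z (cnj z) ^ Suc k) $ Suc m
        = z * (u ^ k * cnj u ^ Suc m * complex_of_real ((blaschke r r ^ k) $ Suc m))
          + (u * cnj u) * (u ^ k * cnj u ^ m * complex_of_real ((blaschke r r ^ k) $ m))
          - cnj z * (u ^ Suc k * cnj u ^ m * complex_of_real ((blaschke r r ^ Suc k) $ m))"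
      unfolding uu using Suc IHk by (simp add: blaschke_mult_nth)
    also have "\<dots> = u ^ Suc k * cnj u ^ Suc m * complex_of_real ((blaschke r r ^ Suc k) $ Suc m)"
      unfolding z by (simp add: blaschke_mult_nth algebra_simps)
    finally show ?case .
  qed
qed

section \<open>The orbit norm of the Toeplitz matrix\<close>

definition fps_of_vec :: "complex vec \<Rightarrow> complex fps" where
  "fps_of_vec v = Abs_fps (\<lambda>i. if i < dim_vec v then vec_index v i else 0)"

lemma fps_of_vec_nth [simp]:
  "fps_nth (fps_of_vec v) i = (if i < dim_vec v then vec_index v i else 0)"
  by (simp add: fps_of_vec_def)

lemma fps_mult_nth_cong:
  assumes "\<And>i. i \<le> m \<Longrightarrow> fps_nth F i = fps_nth G i"
  shows "fps_nth (H * F) m = fps_nth (H * G) m"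
  unfolding fps_mult_nth using assms by (intro sum.cong) auto

lemma toeplitz_carrier [simp]: "toeplitz_mat z n \<in> carrier_mat n n"
  by (simp add: toeplitz_mat_def)

lemma det_toeplitz: "det (toeplitz_mat z n) = z ^ n"
proof -
  have "det (toeplitz_mat z n) = prod_list (diag_mat (toeplitz_mat z n))"
    by (rule det_lower_triangular[of n]) (simp_all add: toeplitz_mat_def)
  also have "diag_mat (toeplitz_mat z n) = map (\<lambda>i. z) [0..<n]"
    by (simp add: diag_mat_def toeplitz_mat_def)
  finally show ?thesis
    by (simp add: map_replicate_trivial)
qed

lemma toeplitz_mult_nth:
  assumes v: "v \<in> carrier_vec n" and i: "i < n"
  shows "vec_index (toeplitz_mat z n *\<^sub>v v) i = fps_nth (blaschke z (cnj z) * fps_of_vec v) i"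
proof -
  let ?\<phi> = "blaschke z (cnj z)"
  have entry: "toeplitz_mat z n $$ (i, j) = (if j \<le> i then fps_nth ?\<phi> (i - j) else 0)" if "j < n" for j
  proof (cases "i - j")
    case 0
    then show ?thesis
      using i that by (auto simp: toeplitz_mat_def blaschke_nth)
  next
    case (Suc m)
    moreover have "(complex_of_real (cmod z))\<^sup>2 = cnj z * z"
      by (metis complex_norm_square mult.commute of_real_power)
    ultimately show ?thesis
      using i that by (auto simp: toeplitz_mat_def blaschke_nth)
  qed
  have "vec_index (toeplitz_mat z n *\<^sub>v v) i = (\<Sum>j<n. toeplitz_mat z n $$ (i, j) * vec_index v j)"
    by (rule mult_mat_vec_index_sum[OF toeplitz_carrier v i])
  also have "\<dots> = (\<Sum>j<n. if j \<le> i then fps_nth ?\<phi> (i - j) * vec_index v j else 0)"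
    using entry by (intro sum.cong) auto
  also have "\<dots> = (\<Sum>j\<in>{j\<in>{..<n}. j \<le> i}. fps_nth ?\<phi> (i - j) * vec_index v j)"
    by (rule sum.inter_filter[symmetric]) simp
  also have "{j\<in>{..<n}. j \<le> i} = {0..i}"
    using i by auto
  also have "(\<Sum>j = 0..i. fps_nth ?\<phi> (i - j) * vec_index v j) = fps_nth (fps_of_vec v * ?\<phi>) i"
    unfolding fps_mult_nth using i v by (intro sum.cong) auto
  finally show ?thesis
    by (simp only: mult.commute)
qed

lemma fps_of_toeplitz_mult_nth:
  assumes "v \<in> carrier_vec n" "i < n"
  shows "fps_nth (fps_of_vec (toeplitz_mat z n *\<^sub>v v)) i = fps_nth (blaschke z (cnj z) * fps_of_vec v) i"
proof -
  have "dim_vec (toeplitz_mat z n *\<^sub>v v) = n"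
    by (simp add: toeplitz_mat_def)
  then show ?thesis
    unfolding toeplitz_mult_nth[OF assms, symmetric] using assms by simp
qed

definition toeplitz_norm :: "complex \<Rightarrow> nat \<Rightarrow> complex vec \<Rightarrow> real" where
  "toeplitz_norm z n v =
     (SUP k. cmod (fps_nth (blaschke z (cnj z) ^ k * fps_of_vec v) (n - 1)))"

context
  fixes z :: complex
  assumes z_less_1: "cmod z < 1" and z_nonzero: "z \<noteq> 0"
begin

lemma polar:
  obtains u where "cmod u = 1" "z = complex_of_real (cmod z) * u"
  using z_nonzero by (intro that[of "z / complex_of_real (cmod z)"]) (auto simp: norm_divide)

lemma cmod_z_square: "(cmod z)\<^sup>2 < 1"
  using z_less_1 by (simp add: power_less_one_iff abs_square_less_1)

lemma blaschke_power_nth_le_1: "cmod (fps_nth (blaschke z (cnj z) ^ k) m) \<le> 1"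
proof -
  obtain u where u: "cmod u = 1" "z = complex_of_real (cmod z) * u"
    by (rule polar)
  let ?a = "fps_nth (blaschke (cmod z) (cmod z) ^ k) m"
  have "?a\<^sup>2 \<le> (\<Sum>j\<le>m. (fps_nth (blaschke (cmod z) (cmod z) ^ k) j)\<^sup>2)"
    by (rule member_le_sum) auto
  also have "\<dots> \<le> 1"
    by (rule blaschke_power_square_sum[OF cmod_z_square])
  finally have "\<bar>?a\<bar> \<le> 1"
    by (simp add: abs_square_le_1)
  then show ?thesis
    unfolding blaschke_power_rotate[OF u] using u(1) by (simp add: norm_mult norm_power)
qed

lemma toeplitz_norm_bdd:
  "bdd_above (range (\<lambda>k. cmod (fps_nth (blaschke z (cnj z) ^ k * fps_of_vec v) m)))"
proof (rule bdd_aboveI2)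
  fix k
  show "cmod (fps_nth (blaschke z (cnj z) ^ k * fps_of_vec v) m)
      \<le> (\<Sum>i = 0..m. cmod (fps_nth (fps_of_vec v) (m - i)))"
    unfolding fps_mult_nth
    using blaschke_power_nth_le_1
    by (intro sum_norm_le) (simp add: norm_mult mult_left_le_one_le del: fps_of_vec_nth)
qed

lemma toeplitz_norm_upper:
  "cmod (fps_nth (blaschke z (cnj z) ^ k * fps_of_vec v) (n - 1)) \<le> toeplitz_norm z n v"
  unfolding toeplitz_norm_def by (rule cSUP_upper[OF UNIV_I toeplitz_norm_bdd])

lemma toeplitz_norm_least:
  "(\<And>k. cmod (fps_nth (blaschke z (cnj z) ^ k * fps_of_vec v) (n - 1)) \<le> c) \<Longrightarrow> toeplitz_norm z n v \<le> c"
  unfolding toeplitz_norm_def by (rule cSUP_least) auto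

text \<open>The series whose orbit is annihilated by the \<open>m\<close>-th coefficient form a subspace invariant under
  \<open>\<phi>\<close>, hence under \<open>\<phi> - z\<close>, which is \<open>X\<close> times a unit. Multiplication by a suitable power of it
  moves the lowest nonzero coefficient to position \<open>m\<close>.\<close>

lemma orbit_functional_cyclic:
  assumes zero: "\<And>k. fps_nth (blaschke z (cnj z) ^ k * F) m = 0" and j: "j \<le> m"
  shows "fps_nth F j = 0"
proof (rule ccontr)
  assume nz: "fps_nth F j \<noteq> 0"
  define l where "l = (LEAST j. fps_nth F j \<noteq> 0)"
  have l: "fps_nth F l \<noteq> 0" and below: "\<And>i. i < l \<Longrightarrow> fps_nth F i = 0"
    and lj: "l \<le> j"
    unfolding l_def using LeastI[of "\<lambda>j. fps_nth F j \<noteq> 0", OF nz]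
      Least_le[of "\<lambda>j. fps_nth F j \<noteq> 0", OF nz] not_less_Least[of _ "\<lambda>j. fps_nth F j \<noteq> 0"]
    by blast+
  let ?\<phi> = "blaschke z (cnj z)"
  define W where "W = fps_shift 1 ?\<phi>"
  have W: "?\<phi> - fps_const z = fps_X * W"
    by (rule fps_ext) (auto simp: W_def blaschke_nth gr0_conv_Suc split: nat.split)
  have W0: "fps_nth W 0 \<noteq> 0"
  proof -
    have "fps_nth W 0 = complex_of_real (1 - (cmod z)\<^sup>2)"
      using blaschke_nth(2)[of z "cnj z" 0] complex_norm_square[of z] by (simp add: W_def mult.commute)
    then show ?thesis
      using cmod_z_square by (simp only: of_real_eq_0_iff)
  qed
  have orbit: "fps_nth (?\<phi> ^ k * ((?\<phi> - fps_const z) ^ i * F)) m = 0" for k i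
  proof (induction i arbitrary: k)
    case 0
    then show ?case using zero by simp
  next
    case (Suc i)
    have "?\<phi> ^ k * ((?\<phi> - fps_const z) ^ Suc i * F)
        = ?\<phi> ^ Suc k * ((?\<phi> - fps_const z) ^ i * F) - fps_const z * (?\<phi> ^ k * ((?\<phi> - fps_const z) ^ i * F))"
      by (simp add: algebra_simps)
    then show ?case
      using Suc[of k] Suc[of "Suc k"] by (simp only: fps_sub_nth fps_mult_left_const_nth) simp
  qed
  have "0 = fps_nth (fps_X ^ (m - l) * (W ^ (m - l) * F)) m"
    using orbit[of 0 "m - l"] unfolding W by (simp add: power_mult_distrib mult.assoc)
  also have "\<dots> = fps_nth (W ^ (m - l) * F) l"
    using lj j by (simp add: fps_X_power_mult_nth)
  also have "\<dots> = (\<Sum>i = 0..l. if i = 0 then fps_nth W 0 ^ (m - l) * fps_nth F l else 0)"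
    unfolding fps_mult_nth using below by (intro sum.cong) (auto simp: fps_power_zeroth)
  also have "\<dots> = fps_nth W 0 ^ (m - l) * fps_nth F l"
    by simp
  finally show False
    using W0 l by simp
qed

lemma is_vec_norm_toeplitz_norm:
  assumes n: "1 \<le> n"
  shows "is_vec_norm n (toeplitz_norm z n)"
proof -
  let ?f = "\<lambda>k v. fps_nth (blaschke z (cnj z) ^ k * fps_of_vec v) (n - 1)"
  let ?N = "toeplitz_norm z n"
  have nonneg: "0 \<le> ?N v" for v
    by (rule order_trans[OF norm_ge_zero toeplitz_norm_upper[of 0]])
  have f_smult: "?f k (a \<cdot>\<^sub>v v) = a * ?f k v" for k a v
  proof -
    have "fps_of_vec (a \<cdot>\<^sub>v v) = fps_const a * fps_of_vec v"
      by (rule fps_ext) simp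
    then have "blaschke z (cnj z) ^ k * fps_of_vec (a \<cdot>\<^sub>v v) = fps_const a * (blaschke z (cnj z) ^ k * fps_of_vec v)"
      by (simp only: mult_ac)
    then show ?thesis
      by (simp only: fps_mult_left_const_nth)
  qed
  have smult_le: "?N (a \<cdot>\<^sub>v v) \<le> cmod a * ?N v" for a v
  proof (rule toeplitz_norm_least)
    show "cmod (?f k (a \<cdot>\<^sub>v v)) \<le> cmod a * ?N v" for k
      unfolding f_smult norm_mult by (intro mult_left_mono toeplitz_norm_upper norm_ge_zero)
  qed
  have smult: "?N (a \<cdot>\<^sub>v v) = cmod a * ?N v" for a v
  proof (cases "a = 0")
    case True
    then show ?thesis
      using smult_le[of a v] nonneg[of "a \<cdot>\<^sub>v v"] by simp
  next
    case False
    have "?N v \<le> cmod (inverse a) * ?N (a \<cdot>\<^sub>v v)"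
      using smult_le[of "inverse a" "a \<cdot>\<^sub>v v"] False by (simp add: smult_smult_assoc)
    then have "cmod a * ?N v \<le> ?N (a \<cdot>\<^sub>v v)"
      using False by (simp add: norm_divide field_simps)
    with smult_le[of a v] show ?thesis
      by simp
  qed
  have definite: "?N v = 0 \<longleftrightarrow> v = 0\<^sub>v n" if v: "v \<in> carrier_vec n" for v
  proof
    assume "?N v = 0"
    then have "?f k v = 0" for k
      using toeplitz_norm_upper[of k v n] by simp
    then have "fps_nth (fps_of_vec v) j = 0" if "j \<le> n - 1" for j
      using that by (rule orbit_functional_cyclic)
    then have "vec_index v j = 0" if "j < n" for j
      using that v by (metis One_nat_def Suc_pred carrier_vecD fps_of_vec_nth less_Suc_eq_le less_nat_zero_code not_gr_zero)
    then show "v = 0\<^sub>v n"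
      using v by (intro eq_vecI) auto
  next
    assume "v = 0\<^sub>v n"
    then have "v = 0 \<cdot>\<^sub>v v"
      by auto
    then show "?N v = 0"
      using smult[of 0 v] by simp
  qed
  have triangle: "?N (v + w) \<le> ?N v + ?N w" if "v \<in> carrier_vec n" "w \<in> carrier_vec n" for v w
  proof (rule toeplitz_norm_least)
    fix k
    have "fps_of_vec (v + w) = fps_of_vec v + fps_of_vec w"
      using that by (intro fps_ext) auto
    then have "?f k (v + w) = ?f k v + ?f k w"
      by (simp only: distrib_left fps_add_nth)
    then have "cmod (?f k (v + w)) \<le> cmod (?f k v) + cmod (?f k w)"
      by (simp only: norm_triangle_ineq)
    also have "\<dots> \<le> ?N v + ?N w"
      by (intro add_mono toeplitz_norm_upper)
    finally show "cmod (?f k (v + w)) \<le> ?N v + ?N w" .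
  qed
  show ?thesis
    unfolding is_vec_norm_def using nonneg definite smult triangle by blast
qed

lemma toeplitz_contraction:
  assumes n: "1 \<le> n" and v: "v \<in> carrier_vec n"
  shows "toeplitz_norm z n (toeplitz_mat z n *\<^sub>v v) \<le> toeplitz_norm z n v"
proof (rule toeplitz_norm_least)
  fix k
  have "fps_nth (blaschke z (cnj z) ^ k * fps_of_vec (toeplitz_mat z n *\<^sub>v v)) (n - 1)
      = fps_nth (blaschke z (cnj z) ^ k * (blaschke z (cnj z) * fps_of_vec v)) (n - 1)"
    using n v by (intro fps_mult_nth_cong fps_of_toeplitz_mult_nth) auto
  also have "\<dots> = fps_nth (blaschke z (cnj z) ^ Suc k * fps_of_vec v) (n - 1)"
    by (simp only: power_Suc2 mult.assoc)
  also have "cmod \<dots> \<le> toeplitz_norm z n v"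
    by (rule toeplitz_norm_upper)
  finally show "cmod (fps_nth (blaschke z (cnj z) ^ k * fps_of_vec (toeplitz_mat z n *\<^sub>v v)) (n - 1))
      \<le> toeplitz_norm z n v" .
qed

text \<open>This is the synthetic division by \<open>z + X\<close>: the last coefficient of the quotient is read off from
  the value of the truncated product at \<open>-z\<close>.\<close>

lemma telescoped_last_coefficient:
  fixes W :: "complex fps"
  shows "(- z) ^ Suc m * fps_nth W m = - (\<Sum>i\<le>m. (- z) ^ i * fps_nth ((fps_const z + fps_X) * W) i)"
proof -
  have "(fps_const z + fps_X) * W = fps_const z * W + fps_X * W"
    by (rule distrib_right)
  then show ?thesis
    by (induction m) (simp_all add: algebra_simps)
qed

text \<open>The polynomial \<open>X\<^sup>2 - (z / \<bar>z\<bar>)\<^sup>2\<close>. Its roots are the two points of the unit circle at which the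
  derivative of the argument of \<open>\<phi>\<close> is extremal.\<close>

definition test_vec :: "nat \<Rightarrow> complex vec" where
  "test_vec n = vec n (\<lambda>i. if i = 0 then - (z / complex_of_real (cmod z))\<^sup>2 else if i = 2 then 1 else 0)"

lemma test_vec_carrier [simp]: "test_vec n \<in> carrier_vec n"
  by (simp add: test_vec_def)

lemma fps_of_test_vec:
  assumes "4 \<le> n"
  shows "fps_of_vec (test_vec n) = fps_X ^ 2 - fps_const ((z / complex_of_real (cmod z))\<^sup>2)"
  using assms by (intro fps_ext) (auto simp: test_vec_def fps_X_power_nth)

text \<open>By \<open>blaschke_power_rotate\<close> the coefficients of \<open>\<phi>\<^sup>k\<close> at the distance 2 differ from the real
  ones by phases whose quotient is \<open>u\<^sup>2\<close>, so that the test vector turns them into a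
  difference of real coefficients.\<close>

lemma test_vec_norm_small:
  obtains C where "0 < C" "\<And>n. 4 \<le> n \<Longrightarrow> toeplitz_norm z n (test_vec n) \<le> C / sqrt (real n)"
proof -
  define r where "r = cmod z"
  define u where "u = z / complex_of_real r"
  have r: "0 < r" "r < 1"
    using z_less_1 z_nonzero by (auto simp: r_def)
  have u: "cmod u = 1" and zu: "z = complex_of_real r * u"
    using r by (auto simp: u_def norm_divide r_def)
  obtain C where C: "0 < C"
    "\<And>k m. \<bar>fps_nth (blaschke r r ^ k) (Suc (Suc m)) - fps_nth (blaschke r r ^ k) m\<bar> \<le> C / sqrt (real (Suc m))"
    using blaschke_power_difference_bound[OF r] by blast
  \<comment> \<open>The factor 2 absorbs the passage from \<open>n - 2\<close> to \<open>n\<close>.\<close>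
  have "toeplitz_norm z n (test_vec n) \<le> (2 * C) / sqrt (real n)" if n: "4 \<le> n" for n
  proof (rule toeplitz_norm_least)
    fix k
    define m where "m = n - 3"
    have nm: "n - 1 = Suc (Suc m)"
      using n by (simp add: m_def)
    let ?F = "blaschke z (cnj z) ^ k" and ?a = "\<lambda>i. fps_nth (blaschke r r ^ k) i"
    have "?F * fps_of_vec (test_vec n) = fps_X ^ 2 * ?F - fps_const (u\<^sup>2) * ?F"
      unfolding fps_of_test_vec[OF n] u_def r_def by (simp add: algebra_simps)
    then have "fps_nth (?F * fps_of_vec (test_vec n)) (n - 1)
        = fps_nth ?F m - u\<^sup>2 * fps_nth ?F (Suc (Suc m))"
      unfolding nm by (simp add: fps_X_power_mult_nth)
    also have "\<dots> = u ^ k * cnj u ^ m * (of_real (?a m) - (u * cnj u)\<^sup>2 * of_real (?a (Suc (Suc m))))"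
      unfolding blaschke_power_rotate[OF u zu] by (simp add: algebra_simps power2_eq_square)
    also have "u * cnj u = 1"
      using u by (simp add: complex_norm_square[symmetric])
    finally have "cmod (fps_nth (?F * fps_of_vec (test_vec n)) (n - 1)) = \<bar>?a m - ?a (Suc (Suc m))\<bar>"
      using u by (simp add: norm_mult norm_power flip: of_real_diff)
    also have "\<dots> \<le> C / sqrt (real (Suc m))"
      using C(2)[of k m] by (simp add: abs_minus_commute)
    also have "\<dots> \<le> C / (sqrt (real n) / 2)"
    proof (rule divide_left_mono)
      have "sqrt (real n) / 2 = sqrt (real n / 4)"
        by (simp add: real_sqrt_divide)
      also have "\<dots> \<le> sqrt (real (Suc m))"
        using n by (intro real_sqrt_le_mono) (simp add: m_def)
      finally show "sqrt (real n) / 2 \<le> sqrt (real (Suc m))" .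
    qed (use C n in auto)
    finally show "cmod (fps_nth (?F * fps_of_vec (test_vec n)) (n - 1)) \<le> (2 * C) / sqrt (real n)"
      by (simp add: mult.commute)
  qed
  with C(1) show thesis
    by (intro that[of "2 * C"]) auto
qed

text \<open>For the image \<open>W\<close> of the test vector \<open>V\<close> the series \<open>\<phi> W\<close> and \<open>z\<^sup>n V\<close> agree below \<open>X\<^sup>n\<close>, and
  clearing the denominator gives \<open>(z + X) W = z\<^sup>n (1 + cnj z X) V\<close> below \<open>X\<^sup>n\<close>. The right-hand side
  has degree 3 and its value at \<open>-z\<close> is \<open>z\<^sup>n (1 - \<bar>z\<bar>\<^sup>2) (z\<^sup>2 - u\<^sup>2)\<close>.\<close>

lemma adjugate_test_vec_large:
  assumes n: "4 \<le> n"
  shows "(1 - (cmod z)\<^sup>2)\<^sup>2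
    \<le> toeplitz_norm z n ((det (toeplitz_mat z n) \<cdot>\<^sub>m mat_inv (toeplitz_mat z n)) *\<^sub>v test_vec n)"
proof -
  let ?T = "toeplitz_mat z n" and ?\<phi> = "blaschke z (cnj z)"
  define u where "u = z / complex_of_real (cmod z)"
  have u: "cmod u = 1" and zu: "z = complex_of_real (cmod z) * u"
    using z_nonzero by (auto simp: u_def norm_divide)
  have det: "det ?T \<noteq> 0"
    using z_nonzero by (simp add: det_toeplitz)
  note inv = mat_inv_eq[OF toeplitz_carrier det]
  define w where "w = (det ?T \<cdot>\<^sub>m mat_inv ?T) *\<^sub>v test_vec n"
  have w: "w \<in> carrier_vec n"
    unfolding w_def using inv(3) by (intro mult_mat_vec_carrier[of _ n n]) auto
  define W where "W = fps_of_vec w"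
  define V where "V = fps_of_vec (test_vec n)"
  have V: "V = fps_X ^ 2 - fps_const (u\<^sup>2)"
    unfolding V_def u_def by (rule fps_of_test_vec[OF n])
  have "?T *\<^sub>v w = z ^ n \<cdot>\<^sub>v test_vec n"
  proof -
    have "?T *\<^sub>v w = ?T *\<^sub>v (z ^ n \<cdot>\<^sub>v (mat_inv ?T *\<^sub>v test_vec n))"
      unfolding w_def det_toeplitz using inv(3) by (simp add: smult_mat_mult_vec[of _ n n])
    also have "\<dots> = z ^ n \<cdot>\<^sub>v (?T *\<^sub>v (mat_inv ?T *\<^sub>v test_vec n))"
      using inv(3) by (intro mult_mat_vec[of _ n n] mult_mat_vec_carrier[of _ n n]) auto
    also have "?T *\<^sub>v (mat_inv ?T *\<^sub>v test_vec n) = test_vec n"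
      using inv assoc_mult_mat_vec[OF toeplitz_carrier[of z] inv(3) test_vec_carrier] by simp
    finally show ?thesis .
  qed
  then have \<phi>W: "fps_nth (?\<phi> * W) i = fps_nth (fps_const (z ^ n) * V) i" if "i < n" for i
    using toeplitz_mult_nth[OF w that, of z] that by (simp add: W_def V_def test_vec_def)
  have "fps_nth ((fps_const z + fps_X) * W) i
      = z ^ n * fps_nth (V + fps_const (cnj z) * (fps_X * V)) i" if "i < n" for i
  proof -
    have "fps_nth ((fps_const z + fps_X) * W) i = fps_nth ((1 + fps_const (cnj z) * fps_X) * (?\<phi> * W)) i"
      by (simp only: denominator_mult_blaschke mult.assoc[symmetric])
    also have "\<dots> = fps_nth ((1 + fps_const (cnj z) * fps_X) * (fps_const (z ^ n) * V)) i"
      using that by (intro fps_mult_nth_cong \<phi>W) auto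
    also have "(1 + fps_const (cnj z) * fps_X) * (fps_const (z ^ n) * V)
        = fps_const (z ^ n) * (V + fps_const (cnj z) * (fps_X * V))"
      by (simp only: distrib_left distrib_right mult_1 mult_ac)
    finally show ?thesis
      by (simp only: fps_mult_left_const_nth)
  qed
  moreover have h: "fps_nth (V + fps_const (cnj z) * (fps_X * V)) i
      = (if i = 0 then - u\<^sup>2 else if i = 1 then - cnj z * u\<^sup>2 else if i = 2 then 1
         else if i = 3 then cnj z else 0)" for i
    unfolding V by (cases i) (auto simp: fps_X_power_nth)
  ultimately have "(- z) ^ Suc (n - 1) * fps_nth W (n - 1)
      = - (\<Sum>i\<le>n - 1. (- z) ^ i * (z ^ n * (if i = 0 then - u\<^sup>2 else if i = 1 then - cnj z * u\<^sup>2
           else if i = 2 then 1 else if i = 3 then cnj z else 0)))"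
    unfolding telescoped_last_coefficient using n by (intro arg_cong[of _ _ uminus] sum.cong) auto
  also have "(\<Sum>i\<le>n - 1. (- z) ^ i * (z ^ n * (if i = 0 then - u\<^sup>2 else if i = 1 then - cnj z * u\<^sup>2
           else if i = 2 then 1 else if i = 3 then cnj z else 0)))
      = (\<Sum>i\<in>{0, 1, 2, 3}. (- z) ^ i * (z ^ n * (if i = 0 then - u\<^sup>2 else if i = 1 then - cnj z * u\<^sup>2
           else if i = 2 then 1 else if i = 3 then cnj z else 0)))"
    using n by (intro sum.mono_neutral_right) auto
  also have "\<dots> = z ^ n * (- u\<^sup>2 + z * cnj z * u\<^sup>2 + z\<^sup>2 - z ^ 3 * cnj z)"
    by (simp add: algebra_simps)
  also have "- u\<^sup>2 + z * cnj z * u\<^sup>2 + z\<^sup>2 - z ^ 3 * cnj z = (1 - z * cnj z) * (z\<^sup>2 - u\<^sup>2)"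
    by (simp add: algebra_simps power2_eq_square power3_eq_cube)
  finally have "cmod ((- z) ^ Suc (n - 1) * fps_nth W (n - 1)) = cmod (z ^ n * ((1 - z * cnj z) * (z\<^sup>2 - u\<^sup>2)))"
    by (simp only: norm_minus_cancel)
  then have "cmod z ^ n * cmod (fps_nth W (n - 1)) = cmod z ^ n * (cmod (1 - z * cnj z) * cmod (z\<^sup>2 - u\<^sup>2))"
    using n by (simp only: norm_mult norm_power norm_minus_cancel) simp
  then have "cmod (fps_nth W (n - 1)) = cmod (1 - z * cnj z) * cmod (z\<^sup>2 - u\<^sup>2)"
    using z_nonzero by simp
  moreover have "1 - z * cnj z = complex_of_real (1 - (cmod z)\<^sup>2)"
    using complex_norm_square[of z] by simp
  moreover have "z\<^sup>2 - u\<^sup>2 = - (complex_of_real (1 - (cmod z)\<^sup>2) * u\<^sup>2)"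
    by (subst zu) (simp add: power_mult_distrib algebra_simps)
  ultimately have "cmod (fps_nth W (n - 1)) = (1 - (cmod z)\<^sup>2)\<^sup>2"
    using u cmod_z_square by (simp add: norm_mult norm_power power2_eq_square[of "1 - (cmod z)\<^sup>2"] del: of_real_diff of_real_power)
  then show ?thesis
    using toeplitz_norm_upper[of 0 w n] by (simp add: W_def w_def del: fps_of_vec_nth)
qed

text \<open>The inverse of a contraction never shrinks a vector. This serves the finitely many \<open>n\<close> that are
  too small for the test vector, whose degree must not exceed \<open>n - 2\<close>.\<close>

lemma adjugate_op_norm_ge_det:
  assumes n: "1 \<le> n"
  shows "cmod z ^ n
    \<le> op_norm n (toeplitz_norm z n) (det (toeplitz_mat z n) \<cdot>\<^sub>m mat_inv (toeplitz_mat z n))"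
proof -
  let ?T = "toeplitz_mat z n" and ?N = "toeplitz_norm z n"
  let ?adj = "det ?T \<cdot>\<^sub>m mat_inv ?T"
  note N = is_vec_norm_toeplitz_norm[OF n]
  have det: "det ?T \<noteq> 0"
    using z_nonzero by (simp add: det_toeplitz)
  note inv = mat_inv_eq[OF toeplitz_carrier det]
  have adj: "?adj \<in> carrier_mat n n"
    using inv(3) by simp
  define e where "e = (unit_vec n 0 :: complex vec)"
  have e: "e \<in> carrier_vec n" "e \<noteq> 0\<^sub>v n"
    using n by (auto simp: e_def)
  have pos: "0 < ?N e"
    using is_vec_normD(1,2)[OF N e(1)] e(2) by linarith
  have ie: "mat_inv ?T *\<^sub>v e \<in> carrier_vec n"
    by (rule mult_mat_vec_carrier[OF inv(3) e(1)])
  have "?T *\<^sub>v (mat_inv ?T *\<^sub>v e) = e"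
    using assoc_mult_mat_vec[OF toeplitz_carrier[of z] inv(3) e(1)] inv(1) e(1) by simp
  then have "?N e \<le> ?N (mat_inv ?T *\<^sub>v e)"
    using toeplitz_contraction[OF n ie] by simp
  then have "cmod z ^ n * ?N e \<le> cmod z ^ n * ?N (mat_inv ?T *\<^sub>v e)"
    by (intro mult_left_mono) auto
  also have "\<dots> = ?N (?adj *\<^sub>v e)"
    unfolding smult_mat_mult_vec[OF inv(3) e(1)] is_vec_normD(3)[OF N ie] det_toeplitz norm_power ..
  also have "\<dots> \<le> op_norm n ?N ?adj * ?N e"
    by (rule vec_norm_mult_le_op_norm[OF N adj e(1)])
  finally show ?thesis
    using pos by simp
qed

lemma adjugate_op_norm_ge_sqrt:
  obtains c where "0 < c"
    "\<And>n. 1 \<le> n \<Longrightarrow> c * sqrt (real n)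
      \<le> op_norm n (toeplitz_norm z n) (det (toeplitz_mat z n) \<cdot>\<^sub>m mat_inv (toeplitz_mat z n))"
proof -
  obtain C where C: "0 < C" "\<And>n. 4 \<le> n \<Longrightarrow> toeplitz_norm z n (test_vec n) \<le> C / sqrt (real n)"
    using test_vec_norm_small by blast
  define b where "b = (1 - (cmod z)\<^sup>2)\<^sup>2"
  \<comment> \<open>The second entry serves \<open>n \<le> 3\<close>, where \<open>sqrt n \<le> 2\<close> and \<open>\<bar>z\<bar>\<^sup>3 \<le> \<bar>z\<bar>\<^sup>n\<close>.\<close>
  define c where "c = min (b / C) (cmod z ^ 3 / 2)"
  have b: "0 < b"
    using cmod_z_square by (simp add: b_def)
  have "0 < c"
    using b C z_nonzero by (simp add: c_def)
  moreover have "c * sqrt (real n)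
      \<le> op_norm n (toeplitz_norm z n) (det (toeplitz_mat z n) \<cdot>\<^sub>m mat_inv (toeplitz_mat z n))"
    (is "_ \<le> ?op") if n: "1 \<le> n" for n
  proof (cases "4 \<le> n")
    case True
    note N = is_vec_norm_toeplitz_norm[OF n]
    have det: "det (toeplitz_mat z n) \<noteq> 0"
      using z_nonzero by (simp add: det_toeplitz)
    have adj: "det (toeplitz_mat z n) \<cdot>\<^sub>m mat_inv (toeplitz_mat z n) \<in> carrier_mat n n"
      using mat_inv_eq(3)[OF toeplitz_carrier det] by simp
    have op: "0 \<le> ?op"
      using op_norm_nonneg[OF N adj] n by simp
    have "b \<le> ?op * toeplitz_norm z n (test_vec n)"
      unfolding b_def
      by (rule order_trans[OF adjugate_test_vec_large[OF True] vec_norm_mult_le_op_norm[OF N adj test_vec_carrier]])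
    also have "\<dots> \<le> ?op * (C / sqrt (real n))"
      by (intro mult_left_mono C(2) True op)
    finally have "b / C * sqrt (real n) \<le> ?op"
      using C(1) n by (simp add: field_simps)
    moreover have "c * sqrt (real n) \<le> b / C * sqrt (real n)"
      by (intro mult_right_mono) (auto simp: c_def)
    ultimately show ?thesis
      by linarith
  next
    case False
    have "sqrt (real n) \<le> 2"
      using False by (intro real_le_lsqrt) auto
    moreover have "c \<le> cmod z ^ 3 / 2"
      unfolding c_def by (rule min.cobounded2)
    ultimately have "c * sqrt (real n) \<le> cmod z ^ 3 / 2 * 2"
      by (intro mult_mono) auto
    also have "\<dots> \<le> cmod z ^ n"
      using False z_less_1 power_decreasing[of n 3 "cmod z"] by simp
    also have "\<dots> \<le> ?op"
      by (rule adjugate_op_norm_ge_det[OF n])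
    finally show ?thesis .
  qed
  ultimately show thesis
    by (rule that)
qed

end

theorem theorem6:
  fixes z :: complex
  assumes "cmod z < 1" and "z \<noteq> 0"
  shows "(\<exists>c>0. \<forall>n\<ge>1.
            power_bounded n (toeplitz_mat z n) \<and>
            invertible_mat (toeplitz_mat z n) \<and>
            (\<exists>N. is_vec_norm n N \<and>
                 op_norm n N (toeplitz_mat z n) \<le> 1 \<and>
                 schaeffer_const n
                   \<ge> op_norm n N (det (toeplitz_mat z n) \<cdot>\<^sub>m mat_inv (toeplitz_mat z n)) \<and>
                 op_norm n N (det (toeplitz_mat z n) \<cdot>\<^sub>m mat_inv (toeplitz_mat z n))
                   \<ge> c * sqrt (real n))) \<and>
         \<not> bdd_above (schaeffer_const ` {1..})"
proof -
  obtain c where c: "0 < c"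
    "\<And>n. 1 \<le> n \<Longrightarrow> c * sqrt (real n)
      \<le> op_norm n (toeplitz_norm z n) (det (toeplitz_mat z n) \<cdot>\<^sub>m mat_inv (toeplitz_mat z n))"
    using adjugate_op_norm_ge_sqrt[OF assms] by blast
  have det: "det (toeplitz_mat z n) \<noteq> 0" for n
    using assms(2) by (simp add: det_toeplitz)
  have norm: "is_vec_norm n (toeplitz_norm z n)" if "1 \<le> n" for n
    by (rule is_vec_norm_toeplitz_norm[OF assms that])
  have contr: "op_norm n (toeplitz_norm z n) (toeplitz_mat z n) \<le> 1" if "1 \<le> n" for n
    using toeplitz_contraction[OF assms that]
    by (intro op_norm_le[OF norm[OF that] toeplitz_carrier]) auto
  have S: "op_norm n (toeplitz_norm z n) (det (toeplitz_mat z n) \<cdot>\<^sub>m mat_inv (toeplitz_mat z n))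
      \<le> schaeffer_const n" if "1 \<le> n" for n
    by (rule schaeffer_const_ge_contraction[OF that norm[OF that] toeplitz_carrier det contr[OF that]])
  have "\<not> bdd_above (schaeffer_const ` {1..})"
  proof
    assume "bdd_above (schaeffer_const ` {1..})"
    then obtain b where b: "\<And>n. 1 \<le> n \<Longrightarrow> schaeffer_const n \<le> b"
      by (auto simp: bdd_above_def)
    obtain n :: nat where n: "(b / c)\<^sup>2 + 1 < real n"
      using reals_Archimedean2 by blast
    then have "1 \<le> n"
      using zero_le_power2[of "b / c"] by linarith
    then have "c * sqrt (real n) \<le> b"
      using c(2) S b by (meson order_trans)
    then have "sqrt (real n) \<le> b / c"
      using c(1) by (simp add: pos_le_divide_eq mult.commute)
    then have "real n \<le> (b / c)\<^sup>2"
      by (rule sqrt_le_D)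
    with n show False
      by simp
  qed
  moreover have "power_bounded n (toeplitz_mat z n)" if "1 \<le> n" for n
    using toeplitz_contraction[OF assms that]
    by (rule power_bounded_if_contraction[OF norm[OF that] toeplitz_carrier])
  moreover have "invertible_mat (toeplitz_mat z n)" for n
    using invertible_mat_iff_det[OF toeplitz_carrier] det by blast
  ultimately show ?thesis
    using c norm contr S
    by (intro conjI exI[of _ c] allI impI exI[of _ "toeplitz_norm z _"])
qed

end
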